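(* Let $G$ and $H$ be cubic graphs on $n_G$ and $n_H$ vertices, respectively. Then $$\chi''_=(G \circ H) = \Delta(G\circ H) + 1 = n_H + 4.$$
   Context: All graphs are finite, simple, undirected. The corona $G\circ H$ is obtained by taking one copy of $G$ and $n_G=|V(G)|$ copies $H_1,\dots,H_{n_G}$ of $H$, and joining the $i$-th vertex of $G$ to every vertex of $H_i$. A $k$-total-coloring of a graph assigns one of $k$ colors to each vertex and each edge so that adjacent vertices, adjacent edges (sharing an endpoint), and a vertex and any edge incident to it all receive different colors. It is equitable if the sizes of any two color classes (counting both vertices and edges) differ by at most one. $\chi''_=(X)$ is the least $k$ such that $X$ has an equitable $k$-total-coloring, and $\Delta(X)$ is the maximum degree of $X$. *)

theory Defs
  imports Main
begin

text \<open>A graph is a pair of a vertex set and a set of edges, an edge being the two-element set of its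
  endpoints. As usual, the vertex set of a graph is not empty.\<close>

type_synonym 'a ugraph = "'a set \<times> 'a set set"

abbreviation verts :: "'a ugraph \<Rightarrow> 'a set" where
  "verts G \<equiv> fst G"

abbreviation edges :: "'a ugraph \<Rightarrow> 'a set set" where
  "edges G \<equiv> snd G"

definition simple_graph :: "'a ugraph \<Rightarrow> bool" where
  "simple_graph G \<longleftrightarrow> finite (verts G) \<and> verts G \<noteq> {} \<and>
     (\<forall>e \<in> edges G. e \<subseteq> verts G \<and> card e = 2)"

definition degree :: "'a ugraph \<Rightarrow> 'a \<Rightarrow> nat" where
  "degree G v = card {e \<in> edges G. v \<in> e}"

definition max_degree :: "'a ugraph \<Rightarrow> nat" where
  "max_degree G = Max (degree G ` verts G)"

definition cubic_graph :: "'a ugraph \<Rightarrow> bool" where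
  "cubic_graph G \<longleftrightarrow> simple_graph G \<and> (\<forall>v \<in> verts G. degree G v = 3)"

text \<open>The copies of \<open>H\<close> are indexed by the vertices of \<open>G\<close>: the vertex \<open>x\<close> of the copy belonging to
  \<open>v\<close> is \<open>Inr (v, x)\<close>.\<close>

definition corona :: "'a ugraph \<Rightarrow> 'b ugraph \<Rightarrow> ('a + 'a \<times> 'b) ugraph" where
  "corona G H =
     (Inl ` verts G \<union> Inr ` (verts G \<times> verts H),
      {Inl ` e | e. e \<in> edges G} \<union>
      {(\<lambda>x. Inr (v, x)) ` e | v e. v \<in> verts G \<and> e \<in> edges H} \<union>
      {{Inl v, Inr (v, x)} | v x. v \<in> verts G \<and> x \<in> verts H})"

text \<open>A total coloring colors the disjoint union \<open>verts G <+> edges G\<close>; the \<open>k\<close> colors are the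
  numbers below \<open>k\<close>.\<close>

definition total_coloring :: "'a ugraph \<Rightarrow> nat \<Rightarrow> ('a + 'a set \<Rightarrow> nat) \<Rightarrow> bool" where
  "total_coloring G k c \<longleftrightarrow>
     (\<forall>x \<in> verts G <+> edges G. c x < k) \<and>
     (\<forall>u \<in> verts G. \<forall>v \<in> verts G. {u, v} \<in> edges G \<longrightarrow> c (Inl u) \<noteq> c (Inl v)) \<and>
     (\<forall>e \<in> edges G. \<forall>f \<in> edges G. e \<noteq> f \<and> e \<inter> f \<noteq> {} \<longrightarrow> c (Inr e) \<noteq> c (Inr f)) \<and>
     (\<forall>v \<in> verts G. \<forall>e \<in> edges G. v \<in> e \<longrightarrow> c (Inl v) \<noteq> c (Inr e))"

definition color_class :: "'a ugraph \<Rightarrow> ('a + 'a set \<Rightarrow> nat) \<Rightarrow> nat \<Rightarrow> ('a + 'a set) set" where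
  "color_class G c i = {x \<in> verts G <+> edges G. c x = i}"

text \<open>All \<open>k\<close> classes are compared, including those of colors that are not used.\<close>

definition equitable_total_coloring :: "'a ugraph \<Rightarrow> nat \<Rightarrow> ('a + 'a set \<Rightarrow> nat) \<Rightarrow> bool" where
  "equitable_total_coloring G k c \<longleftrightarrow> total_coloring G k c \<and>
     (\<forall>i < k. \<forall>j < k. card (color_class G c i) \<le> card (color_class G c j) + 1)"

definition equitable_total_chromatic_number :: "'a ugraph \<Rightarrow> nat" where
  "equitable_total_chromatic_number G = (LEAST k. \<exists>c. equitable_total_coloring G k c)"

text \<open>The minimum is attained: coloring all elements differently is equitable.\<close>

lemma equitable_total_coloring_exists:
  assumes "simple_graph G"
  shows "\<exists>k c. equitable_total_coloring G k c"
proof -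
  have "edges G \<subseteq> Pow (verts G)" and "finite (verts G)"
    using assms by (auto simp: simple_graph_def)
  then have "finite (verts G <+> edges G)"
    by (meson finite_Plus finite_Pow_iff finite_subset)
  then obtain c :: "'a + 'a set \<Rightarrow> nat" and k
    where im: "c ` (verts G <+> edges G) = {i. i < k}" and inj: "inj_on c (verts G <+> edges G)"
    using finite_imp_inj_to_nat_seg by metis
  have eq: "c x = c y \<longleftrightarrow> x = y"
    if "x \<in> verts G <+> edges G" "y \<in> verts G <+> edges G" for x y
    using inj that by (rule inj_on_eq_iff)
  have "u \<noteq> v" if "{u, v} \<in> edges G" for u v
    using that assms by (fastforce simp: simple_graph_def)
  then have "total_coloring G k c"
    unfolding total_coloring_def using im by (auto simp: eq InlI InrI)
  moreover have "card (color_class G c i) \<le> 1" for i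
  proof -
    have "x = y" if "x \<in> color_class G c i" "y \<in> color_class G c i" for x y
      using that eq[of x y] unfolding color_class_def by simp
    then show ?thesis
      by (metis One_nat_def card.infinite card_le_Suc0_iff_eq zero_le)
  qed
  then have "card (color_class G c i) \<le> card (color_class G c j) + 1" for i j
    by (rule trans_le_add2)
  ultimately show ?thesis
    unfolding equitable_total_coloring_def by blast
qed

lemma simple_graph_corona:
  assumes "simple_graph G" and "simple_graph H"
  shows "simple_graph (corona G H)"
proof -
  have "card ((\<lambda>x. Inr (v, x) :: 'a + 'a \<times> 'b) ` e) = card e" for v e
    by (rule card_image) (simp add: inj_on_def)
  moreover have "card (Inl ` e :: ('a + 'a \<times> 'b) set) = card e" for e
    by (rule card_image) simp
  ultimately show ?thesis
    using assms unfolding simple_graph_def corona_def by (auto 0 3)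
qed

end

theory Submission
  imports Defs
begin

text \<open>Let \<open>n\<close> be the number of vertices of \<open>H\<close> and use \<open>n + 4\<close> colors, one more than the degree of
  a vertex of \<open>G\<close> in the corona. First color the edges of \<open>G\<close> equitably and then its vertices greedily,
  which works as there are at least eight colors. Every vertex \<open>v\<close> of \<open>G\<close> now sees a set of four special
  colors, and the joining edges at \<open>v\<close> have to use exactly the other \<open>n\<close> colors. In the copy of \<open>H\<close>
  at \<open>v\<close> the vertices get the \<open>n\<close> nonspecial colors as well, once each, while the edges are split into
  small matchings; bijections avoiding all conflicts come from Hall's theorem. This can be done so that
  every color is used \<open>q\<close> or \<open>q + 1\<close> times in the copy, where the set \<open>S v\<close> of the colors used
  \<open>q + 1\<close> times may be any set of the right size \<open>r\<close>, special colors included. A color of \<open>m\<close> edges of \<open>G\<close>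
  occurs on \<open>|V(G)| - m\<close> elements outside the copies, so its class has
  \<open>(q + 1) |V(G)| - m + |{v. i \<in> S v}|\<close> elements. The values of \<open>m\<close> differ by at most one, and
  choosing for \<open>S v\<close>, one vertex \<open>v\<close> after the other, the \<open>r\<close> colors with the smallest
  classes so far keeps it that way.\<close>

section \<open>Greedy and equitable colorings\<close>

text \<open>Elements are colored one at a time. An element \<open>x\<close> loses the colors in
  \<open>F x\<close> and at most one color for each conflicting element, so \<open>C\<close> always
  has a color left.\<close>

lemma greedy_coloring:
  fixes R :: "'x \<Rightarrow> 'x \<Rightarrow> bool" and F :: "'x \<Rightarrow> 'c set"
  assumes "finite X" and "finite C" and sym: "\<And>x y. R x y \<Longrightarrow> R y x" and irr: "\<And>x. \<not> R x x"
    and "\<And>x. x \<in> X \<Longrightarrow> finite (F x) \<and> card (F x) + card {y \<in> X. R x y} < card C"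
  shows "\<exists>c. (\<forall>x\<in>X. c x \<in> C - F x) \<and> (\<forall>x\<in>X. \<forall>y\<in>X. R x y \<longrightarrow> c x \<noteq> c y)"
  using assms(1,5)
proof (induction X rule: finite_induct)
  case empty
  then show ?case by simp
next
  case (insert x X)
  have "card {z \<in> X. R y z} \<le> card {z \<in> insert x X. R y z}" for y
    using insert.hyps(1) by (intro card_mono) auto
  then have "finite (F y) \<and> card (F y) + card {z \<in> X. R y z} < card C" if "y \<in> X" for y
    using insert.prems[of y] that by (meson add_left_mono insertCI le_less_trans)
  then obtain c where c: "\<forall>x\<in>X. c x \<in> C - F x" "\<forall>x\<in>X. \<forall>y\<in>X. R x y \<longrightarrow> c x \<noteq> c y"
    using insert.IH by blast
  let ?N = "{y \<in> X. R x y}"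
  have "{y \<in> insert x X. R x y} = ?N"
    using irr by auto
  then have lt: "finite (F x)" "card (F x) + card ?N < card C"
    using insert.prems[of x] by auto
  have "card (F x \<union> c ` ?N) \<le> card (F x) + card (c ` ?N)"
    by (rule card_Un_le)
  also have "\<dots> \<le> card (F x) + card ?N"
    using insert.hyps(1) by (simp add: card_image_le)
  finally have "card (F x \<union> c ` ?N) < card C"
    using lt by linarith
  moreover have "finite (F x \<union> c ` ?N)"
    using lt insert.hyps(1) by simp
  ultimately have "\<not> C \<subseteq> F x \<union> c ` ?N"
    by (meson card_mono leD)
  then obtain b where b: "b \<in> C" "b \<notin> F x" "\<forall>y\<in>X. R x y \<longrightarrow> c y \<noteq> b"
    by auto
  have "\<forall>y\<in>insert x X. (c(x := b)) y \<in> C - F y"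
    using b c by auto
  moreover have "\<forall>y\<in>insert x X. \<forall>z\<in>insert x X. R y z \<longrightarrow> (c(x := b)) y \<noteq> (c(x := b)) z"
    using b c irr sym by (auto; metis)
  ultimately show ?case by blast
qed

text \<open>In a coloring minimizing the sum of the squared class sizes, a too large class could still lose
  an element to a smallest class, either directly or through a third class.\<close>

lemma equitable_coloring:
  fixes R :: "'x \<Rightarrow> 'x \<Rightarrow> bool" and C :: "'c set"
  assumes fin: "finite X" and finC: "finite C"
    and sym: "\<And>x y. R x y \<Longrightarrow> R y x" and irr: "\<And>x. \<not> R x x"
    and deg: "\<And>x. x \<in> X \<Longrightarrow> card {y \<in> X. R x y} \<le> d"
    and d: "0 < d" and k: "2 * d \<le> card C"
  shows "\<exists>c. c ` X \<subseteq> C \<and> (\<forall>x\<in>X. \<forall>y\<in>X. R x y \<longrightarrow> c x \<noteq> c y) \<and>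
    (\<forall>i\<in>C. \<forall>j\<in>C. card {x\<in>X. c x = i} \<le> card {x\<in>X. c x = j} + 1)"
proof -
  define proper where "proper c \<longleftrightarrow> c ` X \<subseteq> C \<and> (\<forall>x\<in>X. \<forall>y\<in>X. R x y \<longrightarrow> c x \<noteq> c y)"
    for c :: "'x \<Rightarrow> 'c"
  define cls where "cls c i = {x \<in> X. c x = i}" for c :: "'x \<Rightarrow> 'c" and i
  have fcls[simp]: "finite (cls c i)" for c i
    using fin by (simp add: cls_def)
  have "\<exists>c. (\<forall>x\<in>X. c x \<in> C - {}) \<and> (\<forall>x\<in>X. \<forall>y\<in>X. R x y \<longrightarrow> c x \<noteq> c y)"
    using fin finC sym irr
  proof (rule greedy_coloring)
    fix x assume "x \<in> X"
    then show "finite {} \<and> card {} + card {y \<in> X. R x y} < card C"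
      using deg[of x] d k by simp
  qed auto
  then have "\<exists>c. proper c"
    unfolding proper_def by blast
  then obtain c where c: "proper c"
    and minc: "\<And>c'. proper c' \<Longrightarrow> (\<Sum>i\<in>C. (card (cls c i))\<^sup>2) \<le> (\<Sum>i\<in>C. (card (cls c' i))\<^sup>2)"
    using ex_has_least_nat[of proper _ "\<lambda>c. \<Sum>i\<in>C. (card (cls c i))\<^sup>2"] by blast
  \<comment> \<open>Moving one unit from a class of size \<open>b + 2 + p\<close> to a class of size
    \<open>b\<close> lowers the sum of squares by \<open>2 + 2 * p\<close>, against the minimality
    of \<open>c\<close>. All later moves only have to produce these class sizes.\<close>
  have stable: False
    if c': "proper c'" and ij: "i \<in> C" "j \<in> C" "i \<noteq> j" "card (cls c j) + 2 \<le> card (cls c i)"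
      and i: "Suc (card (cls c' i)) = card (cls c i)" and j: "card (cls c' j) = Suc (card (cls c j))"
      and l: "\<And>l. l \<in> C \<Longrightarrow> l \<noteq> i \<Longrightarrow> l \<noteq> j \<Longrightarrow> card (cls c' l) = card (cls c l)" for c' i j
  proof -
    have split: "(\<Sum>l\<in>C. f l) = f i + f j + (\<Sum>l\<in>C - {i, j}. f l)" for f :: "'c \<Rightarrow> nat"
      using finC ij sum.subset_diff[of "{i, j}" C f] by simp
    have "(\<Sum>l\<in>C - {i, j}. (card (cls c' l))\<^sup>2) = (\<Sum>l\<in>C - {i, j}. (card (cls c l))\<^sup>2)"
      using l by (intro sum.cong) auto
    moreover obtain p where p: "card (cls c i) = card (cls c j) + 2 + p"
      using ij(4) le_Suc_ex by blast
    then have "card (cls c' i) = card (cls c j) + 1 + p"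
      using i by simp
    then have "(card (cls c' i))\<^sup>2 + (card (cls c' j))\<^sup>2 < (card (cls c i))\<^sup>2 + (card (cls c j))\<^sup>2"
      unfolding j p by (simp add: power2_eq_square algebra_simps)
    ultimately show False
      using minc[OF c'] by (simp add: split)
  qed
  have "card (cls c i) \<le> card (cls c j) + 1" if ij0: "i \<in> C" "j \<in> C" for i j
  proof (rule ccontr)
    assume neg: "\<not> ?thesis"
    \<comment> \<open>The small class is replaced by a smallest one; the gap to class
      \<open>i\<close> does not shrink.\<close>
    obtain j where j: "j \<in> C" "\<And>l. l \<in> C \<Longrightarrow> card (cls c j) \<le> card (cls c l)"
      using ex_has_least_nat[of "\<lambda>l. l \<in> C" j "\<lambda>l. card (cls c l)"] ij0 by blast
    have big: "card (cls c j) + 2 \<le> card (cls c i)"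
      using neg j(2)[OF ij0(2)] by linarith
    have ij: "i \<noteq> j" using big by auto
    \<comment> \<open>\<open>B\<close> collects the classes that are blocked: none of their elements
      can be recolored with \<open>j\<close> directly.\<close>
    define B where "B = {l \<in> C - {j}. \<forall>x\<in>cls c l. \<exists>y\<in>cls c j. R y x}"
    have iB: "i \<in> B"
    proof (rule ccontr)
      assume "i \<notin> B"
      then obtain x where x: "x \<in> X" "c x = i" "\<And>y. y \<in> X \<Longrightarrow> c y = j \<Longrightarrow> \<not> R y x"
        unfolding B_def cls_def using ij0 ij by auto
      have "proper (c(x := j))"
        using c x j(1) sym irr unfolding proper_def by (auto; metis)
      moreover have "cls c i = insert x (cls (c(x := j)) i)" "x \<notin> cls (c(x := j)) i"
        "cls (c(x := j)) j = insert x (cls c j)" "x \<notin> cls c j"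
        "\<And>l. l \<noteq> i \<Longrightarrow> l \<noteq> j \<Longrightarrow> cls (c(x := j)) l = cls c l"
        using x ij by (auto simp: cls_def)
      ultimately show False
        by (intro stable[of "c(x := j)" i j] ij0 j(1) ij big) simp_all
    qed
    have finB: "finite B"
      unfolding B_def using finC by simp
    \<comment> \<open>Class \<open>j\<close> conflicts with at most
      \<open>d * card (cls c j)\<close> elements, and these cover all classes in \<open>B\<close>.
      Each such class is at least as large as class \<open>j\<close>, and class \<open>i\<close> is
      strictly larger, so there is no room for \<open>d\<close> of them.\<close>
    have "card B < d"
    proof (rule ccontr)
      assume "\<not> card B < d"
      have "(\<Union>l\<in>B. cls c l) \<subseteq> (\<Union>y\<in>cls c j. {x \<in> X. R y x})"
        unfolding B_def cls_def by blast
      then have "card (\<Union>l\<in>B. cls c l) \<le> card (\<Union>y\<in>cls c j. {x \<in> X. R y x})"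
        using fin by (intro card_mono) auto
      also have "\<dots> \<le> (\<Sum>y\<in>cls c j. card {x \<in> X. R y x})"
        by (rule card_UN_le) simp
      also have "\<dots> \<le> of_nat (card (cls c j)) * d"
        by (rule sum_bounded_above) (simp add: deg cls_def)
      finally have "card (\<Union>l\<in>B. cls c l) \<le> card (cls c j) * d" by simp
      moreover have "card (\<Union>l\<in>B. cls c l) = (\<Sum>l\<in>B. card (cls c l))"
        by (rule card_UN_disjoint[OF finB]) (auto simp: cls_def fin)
      moreover have "(\<Sum>l\<in>B. card (cls c l)) = card (cls c i) + (\<Sum>l\<in>B - {i}. card (cls c l))"
        using finB iB by (simp add: sum.remove)
      moreover have "(card B - 1) * card (cls c j) \<le> (\<Sum>l\<in>B - {i}. card (cls c l))"
        using sum_bounded_below[of "B - {i}" "card (cls c j)" "\<lambda>l. card (cls c l)"] j(2) iB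
        by (auto simp: B_def)
      moreover have "(d - 1) * card (cls c j) \<le> (card B - 1) * card (cls c j)"
        using \<open>\<not> card B < d\<close> by (intro mult_right_mono) auto
      moreover have "card (cls c j) * d = (d - 1) * card (cls c j) + card (cls c j)"
        using d by (cases d) (auto simp: algebra_simps)
      ultimately show False
        using big by linarith
    qed
    \<comment> \<open>The unblocked classes. Since \<open>2 * d \<le> card C\<close>, at least
      \<open>2 * d - 1 - (d - 1) = d\<close> of them remain.\<close>
    define A where "A = C - {j} - B"
    have "card A = card C - 1 - card B"
      unfolding A_def using finB j(1) by (subst card_Diff_subset) (auto simp: B_def)
    then have "d \<le> card A"
      using \<open>card B < d\<close> k by linarith
    have "cls c i \<noteq> {}" using big by force
    then obtain y where y: "y \<in> X" "c y = i"
      unfolding cls_def by blast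
    then obtain y' where y': "y' \<in> X" "c y' = j" "R y' y"
      using iB unfolding B_def cls_def by blast
    let ?N = "{x \<in> X. R y x}"
    \<comment> \<open>One neighbor of \<open>y\<close> already has color \<open>j\<close>, so the
      other neighbor colors number at most \<open>d - 1\<close> and miss some unblocked class
      \<open>l\<close>.\<close>
    have "j \<in> c ` ?N"
      using y' sym by blast
    moreover have "card (c ` ?N) \<le> d"
      using deg[OF y(1)] card_image_le[of ?N c] fin by simp
    ultimately have "card (c ` ?N - {j}) < d"
      using d fin by simp
    moreover have "finite (c ` ?N - {j})" using fin by simp
    ultimately have "\<not> A \<subseteq> c ` ?N - {j}"
      using \<open>d \<le> card A\<close> by (meson card_mono leD le_trans)
    then obtain l where l: "l \<in> A" "\<And>x. x \<in> X \<Longrightarrow> R y x \<Longrightarrow> c x \<noteq> l"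
      unfolding A_def by blast
    have lC: "l \<in> C" "l \<noteq> j" "l \<notin> B" "l \<noteq> i"
      using l iB unfolding A_def by auto
    then obtain z where z: "z \<in> X" "c z = l" "\<And>x. x \<in> X \<Longrightarrow> c x = j \<Longrightarrow> \<not> R x z"
      unfolding B_def cls_def by blast
    \<comment> \<open>A shift along \<open>i\<close>, \<open>l\<close>, \<open>j\<close>: class
      \<open>l\<close> gains \<open>y\<close> and gives up \<open>z\<close>, so its size stays the
      same.\<close>
    let ?c = "c(y := l, z := j)"
    have yz: "y \<noteq> z" using y z lC by auto
    have "proper ?c"
      unfolding proper_def
    proof (intro conjI ballI impI)
      show "?c ` X \<subseteq> C"
        using c lC j(1) unfolding proper_def by auto
    next
      fix u v assume uv: "u \<in> X" "v \<in> X" "R u v"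
      then have "c u \<noteq> c v" "R v u" "u \<noteq> v"
        using c sym irr unfolding proper_def by auto
      then show "?c u \<noteq> ?c v"
        using uv l(2)[of u] l(2)[of v] z(3)[of u] z(3)[of v] lC z(2) by auto
    qed
    moreover have "cls c i = insert y (cls ?c i)" "y \<notin> cls ?c i"
      "cls ?c j = insert z (cls c j)" "z \<notin> cls c j"
      using y z ij yz lC by (auto simp: cls_def)
    moreover have "card (cls ?c t) = card (cls c t)" if "t \<noteq> i" "t \<noteq> j" for t
    proof (cases "t = l")
      case True
      have "cls ?c l = insert y (cls c l - {z})" "y \<notin> cls c l" "z \<in> cls c l"
        using y z lC yz by (auto simp: cls_def)
      then show ?thesis
        using True card_Suc_Diff1[of "cls c l" z] by simp
    next
      case False
      then have "cls ?c t = cls c t"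
        using that y z by (auto simp: cls_def)
      then show ?thesis by simp
    qed
    ultimately show False
      by (intro stable[of ?c i j] ij0 j(1) ij big) simp_all
  qed
  then show ?thesis
    using c unfolding proper_def cls_def by blast
qed

text \<open>Adding one to \<open>r\<close> smallest values keeps a function with values \<open>t\<close> and \<open>t + 1\<close> of this form.\<close>

lemma balanced_subsets:
  fixes f :: "'c \<Rightarrow> int"
  assumes "finite V" and fin: "finite C" and r: "r \<le> card C"
    and f: "\<And>i j. i \<in> C \<Longrightarrow> j \<in> C \<Longrightarrow> f i \<le> f j + 1"
  shows "\<exists>S. (\<forall>v\<in>V. S v \<subseteq> C \<and> card (S v) = r) \<and>
    (\<forall>i\<in>C. \<forall>j\<in>C. f i + int (card {v\<in>V. i \<in> S v}) \<le> f j + int (card {v\<in>V. j \<in> S v}) + 1)"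
  using assms(1)
proof (induction V rule: finite_induct)
  case empty
  then show ?case using f by simp
next
  case (insert w V)
  then obtain S where S: "\<forall>v\<in>V. S v \<subseteq> C \<and> card (S v) = r"
    and bal: "\<forall>i\<in>C. \<forall>j\<in>C. f i + int (card {v\<in>V. i \<in> S v}) \<le> f j + int (card {v\<in>V. j \<in> S v}) + 1"
    by blast
  define h where "h i = f i + int (card {v\<in>V. i \<in> S v})" for i
  define Z where "Z = {i \<in> C. \<forall>j\<in>C. h i \<le> h j}"
  have Z: "Z \<subseteq> C" "finite Z"
    using fin by (auto simp: Z_def)
  \<comment> \<open>\<open>T\<close> takes minimizers of \<open>h\<close> as long as there are any,
    and other colors only once all minimizers are included.\<close>
  have "\<exists>T\<subseteq>C. card T = r \<and> (T \<subseteq> Z \<or> Z \<subseteq> T)"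
  proof (cases "r \<le> card Z")
    case True
    then show ?thesis
      using Z by (meson obtain_subset_with_card_n order_trans)
  next
    case False
    then have "\<exists>T. Z \<subseteq> T \<and> T \<subseteq> C \<and> card T = r"
      using Z fin r by (intro exists_subset_between) auto
    then show ?thesis by blast
  qed
  then obtain T where T: "T \<subseteq> C" "card T = r" "T \<subseteq> Z \<or> Z \<subseteq> T"
    by blast
  let ?S = "S(w := T)"
  have cnt: "f i + int (card {v \<in> insert w V. i \<in> ?S v}) = h i + (if i \<in> T then 1 else 0)" for i
  proof -
    have "{v \<in> insert w V. i \<in> ?S v} = (if i \<in> T then insert w {v \<in> V. i \<in> S v} else {v \<in> V. i \<in> S v})"
      using insert.hyps(2) by auto
    then show ?thesis
      using insert.hyps by (simp add: h_def)
  qed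
  have "h i + (if i \<in> T then 1 else 0) \<le> h j + (if j \<in> T then 1 else 0) + 1"
    if ij: "i \<in> C" "j \<in> C" for i j
  proof -
    have le: "h i \<le> h j + 1"
      using bal ij by (simp add: h_def)
    show ?thesis
    proof (cases "i \<in> T \<and> j \<notin> T")
      case True
      have "h i \<le> h j"
      proof (cases "i \<in> Z")
        case True
        then show ?thesis
          using ij(2) by (simp add: Z_def)
      next
        case False
        \<comment> \<open>Here \<open>T\<close> contains a color outside \<open>Z\<close>, hence all
          of \<open>Z\<close>. So \<open>h j\<close> exceeds the minimum, which \<open>h i\<close>
          exceeds by at most one.\<close>
        then have "j \<notin> Z" using T True by blast
        then obtain l where "l \<in> C" "h l < h j"
          using ij by (auto simp: Z_def not_le)
        moreover have "h i \<le> h l + 1"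
          using bal ij \<open>l \<in> C\<close> by (simp add: h_def)
        ultimately show ?thesis by linarith
      qed
      then show ?thesis using True by simp
    next
      case False
      then show ?thesis using le by auto
    qed
  qed
  then have "\<forall>i\<in>C. \<forall>j\<in>C. f i + int (card {v \<in> insert w V. i \<in> ?S v}) \<le> f j + int (card {v \<in> insert w V. j \<in> ?S v}) + 1"
    unfolding cnt by blast
  moreover have "\<forall>v\<in>insert w V. ?S v \<subseteq> C \<and> card (?S v) = r"
    using S T by simp
  ultimately show ?case by blast
qed

section \<open>Bijections avoiding conflicts\<close>

text \<open>Induction on the size of \<open>I\<close>, split by whether some nonempty proper subset
  is tight, that is, has no more values available than members.\<close>

lemma hall_marriage:
  assumes "finite I" and "\<And>i. i \<in> I \<Longrightarrow> finite (S i)"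
    and "\<And>J. J \<subseteq> I \<Longrightarrow> card J \<le> card (\<Union>i\<in>J. S i)"
  shows "\<exists>f. inj_on f I \<and> (\<forall>i\<in>I. f i \<in> S i)"
  using assms
proof (induction "card I" arbitrary: I S rule: less_induct)
  case less
  note finI = less.prems(1) and finS = less.prems(2) and hall = less.prems(3)
  show ?case
  proof (cases "\<exists>J. J \<noteq> {} \<and> J \<subset> I \<and> card (\<Union>i\<in>J. S i) \<le> card J")
    case True
    then obtain J where J: "J \<noteq> {}" "J \<subset> I" "card (\<Union>i\<in>J. S i) \<le> card J"
      by blast
    have finJ: "finite J"
      using J finI by (meson finite_subset psubset_imp_subset)
    let ?U = "\<Union>i\<in>J. S i"
    have finU: "finite ?U"
      using finJ finS J by blast
    have "\<exists>f. inj_on f J \<and> (\<forall>i\<in>J. f i \<in> S i)"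
      by (rule less.hyps) (use J finI finS hall finJ in \<open>auto simp: psubset_card_mono\<close>)
    then obtain f where f: "inj_on f J" "\<forall>i\<in>J. f i \<in> S i"
      by blast
    \<comment> \<open>A tight \<open>J\<close> uses up all of its values. The rest still satisfies
      Hall's condition without them: apply the condition to \<open>K \<union> J\<close> and subtract
      the part of \<open>J\<close>.\<close>
    have "\<exists>g. inj_on g (I - J) \<and> (\<forall>i\<in>I - J. g i \<in> S i - ?U)"
    proof (rule less.hyps)
      show "card (I - J) < card I"
        using J finI by (intro psubset_card_mono) auto
    next
      fix K assume K: "K \<subseteq> I - J"
      then have finK: "finite K"
        using finI finite_subset by blast
      have "card K + card J = card (K \<union> J)"
        using K finK finJ by (subst card_Un_disjoint) auto
      also have "\<dots> \<le> card (\<Union>i\<in>K \<union> J. S i)"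
        by (rule hall) (use K J in auto)
      also have "(\<Union>i\<in>K \<union> J. S i) = (\<Union>i\<in>K. S i - ?U) \<union> ?U"
        by auto
      also have "card \<dots> \<le> card (\<Union>i\<in>K. S i - ?U) + card ?U"
        by (rule card_Un_le)
      finally show "card K \<le> card (\<Union>i\<in>K. S i - ?U)"
        using J(3) by linarith
    qed (use finI finS in auto)
    then obtain g where g: "inj_on g (I - J)" "\<forall>i\<in>I - J. g i \<in> S i - ?U"
      by blast
    let ?h = "\<lambda>i. if i \<in> J then f i else g i"
    have "inj_on ?h I"
    proof (rule inj_onI)
      fix x y assume xy: "x \<in> I" "y \<in> I" "?h x = ?h y"
      consider "x \<in> J" "y \<in> J" | "x \<in> J" "y \<notin> J" | "x \<notin> J" "y \<in> J" | "x \<notin> J" "y \<notin> J"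
        by blast
      then show "x = y"
      proof cases
        case 1
        then show ?thesis using xy f(1) by (simp add: inj_on_eq_iff)
      next
        case 2
        then show ?thesis using xy f(2) g(2) by auto
      next
        case 3
        then show ?thesis using xy f(2) g(2) by (metis DiffD2 DiffI UN_I)
      next
        case 4
        then show ?thesis using xy g(1) by (simp add: inj_on_eq_iff)
      qed
    qed
    moreover have "\<forall>i\<in>I. ?h i \<in> S i"
      using f g by auto
    ultimately show ?thesis by blast
  next
    case no_tight: False
    show ?thesis
    proof (cases "I = {}")
      case True
      then show ?thesis by simp
    next
      case nonempty: False
      then obtain a where a: "a \<in> I" by blast
      have "card {a} \<le> card (\<Union>i\<in>{a}. S i)"
        by (rule hall) (use a in simp)
      then obtain y where y: "y \<in> S a"
        by fastforce
      \<comment> \<open>Without tight subsets every nonempty proper subset has a value to spare, so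
        giving \<open>y\<close> to \<open>a\<close> does no harm.\<close>
      have "\<exists>g. inj_on g (I - {a}) \<and> (\<forall>i\<in>I - {a}. g i \<in> S i - {y})"
      proof (rule less.hyps)
        show "card (I - {a}) < card I"
          using a finI by (meson card_Diff1_less)
      next
        fix K assume K: "K \<subseteq> I - {a}"
        show "card K \<le> card (\<Union>i\<in>K. S i - {y})"
        proof (cases "K = {}")
          case False
          moreover have "K \<subset> I" using K a by blast
          ultimately have "card K < card (\<Union>i\<in>K. S i)"
            using no_tight by (meson linorder_not_le)
          moreover have "(\<Union>i\<in>K. S i - {y}) = (\<Union>i\<in>K. S i) - {y}"
            by auto
          ultimately show ?thesis
            using diff_card_le_card_Diff[of "{y}" "\<Union>i\<in>K. S i"] by simp
        qed simp
      qed (use finI finS in auto)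
      then obtain g where "inj_on g (I - {a})" "\<forall>i\<in>I - {a}. g i \<in> S i - {y}"
        by blast
      then have "inj_on (g(a := y)) I" "\<forall>i\<in>I. (g(a := y)) i \<in> S i"
        using y by (auto simp: inj_on_def)
      then show ?thesis by blast
    qed
  qed
qed

text \<open>For a set \<open>A\<close> with \<open>card A + a \<le> card Y\<close> a single member
  already has enough allowed values, so Hall's condition needs checking for large sets only. An
  injection between finite sets of equal size is a bijection.\<close>

lemma bij_betw_avoiding:
  assumes "finite X" and "finite Y" and card: "card X = card Y"
    and few: "\<And>x. x \<in> X \<Longrightarrow> card {y \<in> Y. bad x y} \<le> a"
    and many: "\<And>A. A \<subseteq> X \<Longrightarrow> A \<noteq> {} \<Longrightarrow> card Y < card A + a \<Longrightarrow>
      card A + card {y \<in> Y. \<forall>x\<in>A. bad x y} \<le> card Y"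
  shows "\<exists>f. bij_betw f X Y \<and> (\<forall>x\<in>X. \<not> bad x (f x))"
proof -
  have "\<exists>f. inj_on f X \<and> (\<forall>x\<in>X. f x \<in> {y \<in> Y. \<not> bad x y})"
    using \<open>finite X\<close>
  proof (rule hall_marriage)
    fix A assume A: "A \<subseteq> X"
    show "card A \<le> card (\<Union>x\<in>A. {y \<in> Y. \<not> bad x y})"
    proof (cases "A = {}")
      case False
      then obtain x where x: "x \<in> A" by blast
      have le: "card {y \<in> Y. \<not> bad x y} \<le> card (\<Union>x\<in>A. {y \<in> Y. \<not> bad x y})"
        using x \<open>finite Y\<close> A \<open>finite X\<close> by (intro card_mono) (auto intro: finite_subset)
      have "{y \<in> Y. \<not> bad x y} = Y - {y \<in> Y. bad x y}" by auto
      then have one: "card {y \<in> Y. \<not> bad x y} = card Y - card {y \<in> Y. bad x y}"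
        using \<open>finite Y\<close> by (simp add: card_Diff_subset)
      have "(\<Union>x\<in>A. {y \<in> Y. \<not> bad x y}) = Y - {y \<in> Y. \<forall>x\<in>A. bad x y}" by auto
      then have all: "card (\<Union>x\<in>A. {y \<in> Y. \<not> bad x y}) = card Y - card {y \<in> Y. \<forall>x\<in>A. bad x y}"
        using \<open>finite Y\<close> by (simp add: card_Diff_subset)
      show ?thesis
      proof (cases "card Y < card A + a")
        case True
        then show ?thesis
          using many[OF A False] all by linarith
      next
        case small: False
        then show ?thesis
          using le one few[of x] x A by fastforce
      qed
    qed simp
  qed (use \<open>finite Y\<close> in auto)
  then obtain f where f: "inj_on f X" "\<forall>x\<in>X. f x \<in> Y \<and> \<not> bad x (f x)"
    by auto
  then have "f ` X = Y"
    using \<open>finite Y\<close> card by (intro card_subset_eq) (auto simp: card_image)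
  then show ?thesis
    using f unfolding bij_betw_def by blast
qed

section \<open>Colorings with prescribed class sizes\<close>

text \<open>Greedy choice: every chosen element removes at most \<open>d + 1\<close> elements,
  itself included. The numerical hypothesis says that after \<open>m - 1\<close> choices something
  is left.\<close>

lemma independent_subset:
  fixes R :: "'x \<Rightarrow> 'x \<Rightarrow> bool"
  assumes "finite X" and sym: "\<And>x y. R x y \<Longrightarrow> R y x" and irr: "\<And>x. \<not> R x x"
    and "\<And>x. x \<in> X \<Longrightarrow> card {y \<in> X. R x y} \<le> d"
    and "m * Suc d < card X + Suc d"
  shows "\<exists>M\<subseteq>X. card M = m \<and> (\<forall>x\<in>M. \<forall>y\<in>M. \<not> R x y)"
  using assms(1,4,5)
proof (induction m arbitrary: X)
  case 0
  then show ?case by (intro exI[of _ "{}"]) simp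
next
  case (Suc m)
  then have "card X > 0" by simp
  then obtain x where x: "x \<in> X" by fastforce
  let ?X = "X - insert x {y \<in> X. R x y}"
  have "card (insert x {y \<in> X. R x y}) \<le> Suc d"
    using Suc.prems(1) Suc.prems(2)[OF x] by (simp add: card_insert_if)
  then have "card X \<le> card ?X + Suc d"
    using diff_card_le_card_Diff[of "insert x {y \<in> X. R x y}" X] Suc.prems(1) by simp
  then have m: "m * Suc d < card ?X + Suc d"
    using Suc.prems(3) by simp
  have "card {z \<in> ?X. R y z} \<le> d" if "y \<in> ?X" for y
  proof -
    have "card {z \<in> ?X. R y z} \<le> card {z \<in> X. R y z}"
      using Suc.prems(1) by (intro card_mono) auto
    then show ?thesis
      using Suc.prems(2)[of y] that by simp
  qed
  then obtain M where M: "M \<subseteq> ?X" "card M = m" "\<forall>x\<in>M. \<forall>y\<in>M. \<not> R x y"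
    using Suc.IH[of ?X] Suc.prems(1) m by auto
  have "finite M" "x \<notin> M"
    using M(1) Suc.prems(1) by (auto intro: finite_subset)
  then have "card (insert x M) = Suc m"
    using M by simp
  moreover have "insert x M \<subseteq> X" using M(1) x by auto
  moreover have "\<forall>u\<in>insert x M. \<forall>v\<in>insert x M. \<not> R u v"
    using M irr sym by blast
  ultimately show ?case by blast
qed

text \<open>The sets are chosen one after another among the elements not yet used; the surplus of
  eight elements keeps the greedy choice possible up to the last set.\<close>

lemma disjoint_independent_family:
  fixes R :: "'x \<Rightarrow> 'x \<Rightarrow> bool" and g :: "'c \<Rightarrow> nat"
  assumes finE: "finite E" and sym: "\<And>x y. R x y \<Longrightarrow> R y x" and irr: "\<And>x. \<not> R x x"
    and deg: "\<And>x. x \<in> E \<Longrightarrow> card {y \<in> E. R x y} \<le> 4"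
    and "finite I" and "\<And>i. i \<in> I \<Longrightarrow> g i \<le> 3" and "sum g I + 8 \<le> card E"
  shows "\<exists>M. (\<forall>i\<in>I. M i \<subseteq> E \<and> card (M i) = g i \<and> (\<forall>x\<in>M i. \<forall>y\<in>M i. \<not> R x y)) \<and>
    (\<forall>i\<in>I. \<forall>j\<in>I. i \<noteq> j \<longrightarrow> M i \<inter> M j = {})"
  using assms(5-7)
proof (induction I rule: finite_induct)
  case empty
  then show ?case by simp
next
  case (insert a I)
  then obtain M where M: "\<forall>i\<in>I. M i \<subseteq> E \<and> card (M i) = g i \<and> (\<forall>x\<in>M i. \<forall>y\<in>M i. \<not> R x y)"
    and disj: "\<forall>i\<in>I. \<forall>j\<in>I. i \<noteq> j \<longrightarrow> M i \<inter> M j = {}"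
    by auto
  let ?X = "E - (\<Union>i\<in>I. M i)"
  have finM: "finite (M i)" if "i \<in> I" for i
    using M that finE finite_subset by blast
  have "card (\<Union>i\<in>I. M i) = (\<Sum>i\<in>I. card (M i))"
    using finM disj insert.hyps(1) by (intro card_UN_disjoint) auto
  also have "\<dots> = sum g I"
    using M by simp
  finally have "card ?X = card E - sum g I"
    using M finM insert.hyps(1) by (subst card_Diff_subset) auto
  then have "g a * Suc 4 < card ?X + Suc 4"
    using insert.prems(1)[of a] insert.prems(2) insert.hyps by simp
  moreover have "card {y \<in> ?X. R x y} \<le> 4" if "x \<in> ?X" for x
  proof -
    have "card {y \<in> ?X. R x y} \<le> card {y \<in> E. R x y}"
      using finE by (intro card_mono) auto
    then show ?thesis
      using deg[of x] that by simp
  qed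
  ultimately have "\<exists>K\<subseteq>?X. card K = g a \<and> (\<forall>x\<in>K. \<forall>y\<in>K. \<not> R x y)"
    using independent_subset[of ?X R 4 "g a"] finE sym irr by simp
  then obtain K where K: "K \<subseteq> ?X" "card K = g a" "\<forall>x\<in>K. \<forall>y\<in>K. \<not> R x y"
    by blast
  have "\<forall>i\<in>insert a I. (M(a := K)) i \<subseteq> E \<and> card ((M(a := K)) i) = g i \<and>
      (\<forall>x\<in>(M(a := K)) i. \<forall>y\<in>(M(a := K)) i. \<not> R x y)"
    using M K by auto
  moreover have "\<forall>i\<in>insert a I. \<forall>j\<in>insert a I. i \<noteq> j \<longrightarrow> (M(a := K)) i \<inter> (M(a := K)) j = {}"
    using disj K by auto
  ultimately show ?case by blast
qed

text \<open>An augmentation argument. The nine edges of a cubic graph on six vertices have to yield four pairs,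
  for which choosing pairs greedily is not enough.\<close>

lemma disjoint_independent_pairs:
  fixes R :: "'x \<Rightarrow> 'x \<Rightarrow> bool"
  assumes finE: "finite E" and sym: "\<And>x y. R x y \<Longrightarrow> R y x" and irr: "\<And>x. \<not> R x x"
    and deg: "\<And>x. x \<in> E \<Longrightarrow> card {y \<in> E. R x y} \<le> 4"
    and nine: "9 \<le> card E" and "t \<le> 4"
  shows "\<exists>P. finite P \<and> card P = t \<and> pairwise disjnt P \<and>
    (\<forall>p\<in>P. p \<subseteq> E \<and> card p = 2 \<and> (\<forall>x\<in>p. \<forall>y\<in>p. \<not> R x y))"
  using \<open>t \<le> 4\<close>
proof (induction t)
  case 0
  then show ?case by (intro exI[of _ "{}"]) simp
next
  case (Suc t)
  then obtain P where P: "finite P" "card P = t" "pairwise disjnt P"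
    and Pp: "\<And>p. p \<in> P \<Longrightarrow> p \<subseteq> E \<and> card p = 2 \<and> (\<forall>x\<in>p. \<forall>y\<in>p. \<not> R x y)"
    by auto
  have finp: "finite p" if "p \<in> P" for p
    using Pp[OF that] finE finite_subset by blast
  have "card (\<Union>P) = sum card P"
    using P(3) finp by (intro card_Union_disjoint) auto
  also have "\<dots> = 2 * t"
    using Pp P(2) by simp
  finally have cardU: "card (\<Union>P) = 2 * t" .
  have sub: "\<Union>P \<subseteq> E" using Pp by blast
  have cardX: "card (E - \<Union>P) = card E - 2 * t"
    using sub finE cardU by (simp add: card_Diff_subset finite_subset)
  show ?case
  proof (cases "\<exists>x\<in>E - \<Union>P. \<exists>y\<in>E - \<Union>P. x \<noteq> y \<and> \<not> R x y")
    case True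
    then obtain x y where xy: "x \<in> E" "x \<notin> \<Union>P" "y \<in> E" "y \<notin> \<Union>P" "x \<noteq> y" "\<not> R x y"
      by blast
    let ?P = "insert {x, y} P"
    have "{x, y} \<notin> P" using xy by blast
    then have "card ?P = Suc t" using P by simp
    moreover have "pairwise disjnt ?P"
      using P(3) xy by (auto simp: pairwise_insert disjnt_def)
    moreover have "\<forall>p\<in>?P. p \<subseteq> E \<and> card p = 2 \<and> (\<forall>x\<in>p. \<forall>y\<in>p. \<not> R x y)"
      using Pp xy sym irr by auto
    ultimately show ?thesis
      using P(1) by (intro exI[of _ ?P]) simp
  next
    case False
    \<comment> \<open>No pair can be added directly, so the uncovered elements are pairwise adjacent
      and all nonneighbors of an uncovered element are covered by \<open>P\<close>.\<close>
    then have adj: "R u v" if "u \<in> E - \<Union>P" "v \<in> E - \<Union>P" "u \<noteq> v" for u v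
      using that by blast
    \<comment> \<open>As \<open>t\<close> is at most 3, at least \<open>9 - 2 * 3 = 3\<close>
      elements are uncovered.\<close>
    have "\<exists>x y. x \<in> E - \<Union>P \<and> y \<in> E - \<Union>P \<and> x \<noteq> y"
    proof -
      have "\<not> card (E - \<Union>P) \<le> Suc 0"
        using cardX nine Suc.prems by simp
      then show ?thesis
        using finE by (auto simp: card_le_Suc0_iff_eq)
    qed
    then obtain x y where x: "x \<in> E" "x \<notin> \<Union>P" and y: "y \<in> E" "y \<notin> \<Union>P" and xy: "x \<noteq> y"
      by blast
    \<comment> \<open>The nonneighbors of \<open>z\<close>. There are at least four:
      \<open>z\<close> and its neighbors make up at most five of the nine or more elements.\<close>
    define N where "N z = E - insert z {w \<in> E. R z w}" for z
    have N4: "4 \<le> card (N z)" if "z \<in> E" for z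
    proof -
      have "card (insert z {w \<in> E. R z w}) \<le> 5"
        using deg[OF that] finE by (simp add: card_insert_if)
      then show ?thesis
        using diff_card_le_card_Diff[of "insert z {w \<in> E. R z w}" E] finE nine
        by (simp add: N_def)
    qed
    have Nsum: "card (N z) = (\<Sum>p\<in>P. card (N z \<inter> p))" if "z \<in> E" "z \<notin> \<Union>P" for z
    proof -
      have "w \<in> \<Union>P" if "w \<in> N z" for w
        by (rule ccontr) (use adj[of z w] that \<open>z \<in> E\<close> \<open>z \<notin> \<Union>P\<close> in \<open>auto simp: N_def\<close>)
      then have "N z = (\<Union>p\<in>P. N z \<inter> p)"
        by auto
      also have "card \<dots> = (\<Sum>p\<in>P. card (N z \<inter> p))"
        using P(1,3) finp by (intro card_UN_disjoint) (auto simp: pairwise_def disjnt_def)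
      finally show ?thesis .
    qed
    \<comment> \<open>The nonneighbors of \<open>x\<close> and of \<open>y\<close> give at least
      eight incidences with at most three pairs, so some pair gets three of its four possible
      ones.\<close>
    have "\<exists>p\<in>P. 2 < card (N x \<inter> p) + card (N y \<inter> p)"
    proof (rule ccontr)
      assume "\<not> ?thesis"
      then have "(\<Sum>p\<in>P. card (N x \<inter> p) + card (N y \<inter> p)) \<le> of_nat (card P) * 2"
        by (intro sum_bounded_above) auto
      then show False
        using N4[OF x(1)] N4[OF y(1)] Nsum[OF x] Nsum[OF y] Suc.prems P(2)
        by (simp add: sum.distrib)
    qed
    then obtain p where p: "p \<in> P" "2 < card (N x \<inter> p) + card (N y \<inter> p)"
      by blast
    obtain a b where ab: "p = {a, b}" "a \<noteq> b"
      using Pp[OF p(1)] by (auto simp: card_2_iff)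
    \<comment> \<open>With three of the four incidences present, one of the two ways of assigning
      the members of \<open>p\<close> to \<open>x\<close> and \<open>y\<close> is free of
      conflicts.\<close>
    have "\<exists>u v. p = {u, v} \<and> u \<noteq> v \<and> u \<in> N x \<and> v \<in> N y"
    proof (rule ccontr)
      assume "\<not> ?thesis"
      then have "\<not> (a \<in> N x \<and> b \<in> N y)" "\<not> (b \<in> N x \<and> a \<in> N y)"
        using ab by blast+
      moreover have "N z \<inter> p = (if a \<in> N z then {a} else {}) \<union> (if b \<in> N z then {b} else {})" for z
        using ab by auto
      ultimately show False
        using p(2) ab(2) by (auto split: if_splits)
    qed
    then obtain u v where uv: "p = {u, v}" "u \<noteq> v" "u \<in> N x" "v \<in> N y"
      by blast
    have uv': "u \<in> E" "v \<in> E" "\<not> R x u" "\<not> R y v" "x \<noteq> u" "y \<noteq> v"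
      using uv unfolding N_def by auto
    have notin: "u \<notin> q" "v \<notin> q" if "q \<in> P - {p}" for q
    proof -
      have "p \<inter> q = {}"
        using P(3) p(1) that by (metis DiffE disjnt_def pairwiseD singletonI)
      then show "u \<notin> q" "v \<notin> q" using uv(1) by auto
    qed
    have xyuv: "x \<noteq> v" "y \<noteq> u"
      using x y p(1) uv(1) by auto
    \<comment> \<open>The augmentation: \<open>{u, v}\<close> is split up, and its members are
      paired with \<open>x\<close> and \<open>y\<close>.\<close>
    let ?P = "insert {x, u} (insert {y, v} (P - {p}))"
    have "{y, v} \<notin> P - {p}" "{x, u} \<notin> insert {y, v} (P - {p})"
      using x y xy xyuv by (auto simp: doubleton_eq_iff)
    then have "card ?P = Suc t"
      using P p(1) card_gt_0_iff[of P] by auto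
    moreover have "pairwise disjnt ?P"
      using P(3) x y xy uv(2) xyuv uv' notin
      by (auto simp: pairwise_insert disjnt_def intro: pairwise_subset)
    moreover have "\<forall>p\<in>?P. p \<subseteq> E \<and> card p = 2 \<and> (\<forall>x\<in>p. \<forall>y\<in>p. \<not> R x y)"
      using Pp x y uv' sym irr by auto
    ultimately show ?thesis
      using P(1) by (intro exI[of _ ?P]) simp
  qed
qed

text \<open>Classes with at most one element carry no conflict. So only the classes in
  \<open>I\<close> have to be chosen with care; the remaining elements are matched arbitrarily with
  the colors in \<open>D\<close>, which are equally many because the sizes add up to
  \<open>card E\<close>.\<close>

lemma coloring_of_family:
  fixes R :: "'x \<Rightarrow> 'x \<Rightarrow> bool" and g :: "'c \<Rightarrow> nat"
  assumes finE: "finite E" and finC: "finite C" and I: "I \<subseteq> C" and irr: "\<And>x. \<not> R x x"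
    and M: "\<And>i. i \<in> I \<Longrightarrow> M i \<subseteq> E \<and> card (M i) = g i \<and> (\<forall>x\<in>M i. \<forall>y\<in>M i. \<not> R x y)"
    and disj: "\<And>i j. i \<in> I \<Longrightarrow> j \<in> I \<Longrightarrow> i \<noteq> j \<Longrightarrow> M i \<inter> M j = {}"
    and one: "\<And>i. i \<in> C - I \<Longrightarrow> g i \<le> 1" and total: "sum g C = card E"
  shows "\<exists>c. c ` E \<subseteq> C \<and> (\<forall>x\<in>E. \<forall>y\<in>E. R x y \<longrightarrow> c x \<noteq> c y) \<and>
    (\<forall>i\<in>C. card {x\<in>E. c x = i} = g i) \<and> (\<forall>i\<in>I. {x\<in>E. c x = i} = M i)"
proof -
  define U where "U = E - (\<Union>i\<in>I. M i)"
  define D where "D = {i \<in> C - I. g i = 1}"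
  have fin: "finite I" "finite D" "finite U"
    using finE finC I by (auto simp: U_def D_def intro: finite_subset)
  have finM: "finite (M i)" if "i \<in> I" for i
    using M[OF that] finE finite_subset by blast
  have "card (\<Union>i\<in>I. M i) = (\<Sum>i\<in>I. card (M i))"
    using finM disj fin(1) by (intro card_UN_disjoint) auto
  also have "\<dots> = sum g I"
    using M by simp
  finally have "card U = card E - sum g I"
    unfolding U_def using M finM fin(1) by (subst card_Diff_subset) auto
  also have "\<dots> = sum g (C - I)"
    using total sum.subset_diff[OF I finC, of g] by simp
  also have "\<dots> = sum g D"
    using finC one by (intro sum.mono_neutral_right) (fastforce simp: D_def)+
  also have "\<dots> = card D"
    by (simp add: D_def)
  finally obtain b where b: "bij_betw b U D"
    using fin finite_same_card_bij by blast
  define c where "c x = (if x \<in> U then b x else (THE i. i \<in> I \<and> x \<in> M i))" for x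
  have cM: "c x = i" if "i \<in> I" "x \<in> M i" for i x
  proof -
    have "(THE i. i \<in> I \<and> x \<in> M i) = i"
      using that disj by (intro the_equality) blast+
    moreover have "x \<notin> U" using that by (auto simp: U_def)
    ultimately show ?thesis by (simp add: c_def)
  qed
  have cU: "c x = b x" "b x \<in> D" if "x \<in> U" for x
    using that b by (auto simp: c_def bij_betw_def)
  have cases: "x \<in> U \<or> (\<exists>i\<in>I. x \<in> M i)" if "x \<in> E" for x
    using that by (auto simp: U_def)
  have inM: "x \<in> M (c x)" if "x \<in> E" "c x \<in> I" for x
    using cases[OF that(1)] cU[of x] cM that(2) by (auto simp: D_def)
  have inU: "x \<in> U" if "x \<in> E" "c x \<notin> I" for x
    using cases[OF that(1)] cM that(2) by blast
  have clsI: "{x \<in> E. c x = i} = M i" if i: "i \<in> I" for i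
  proof
    show "M i \<subseteq> {x \<in> E. c x = i}"
      using M[OF i] cM[OF i] by blast
    show "{x \<in> E. c x = i} \<subseteq> M i"
      using inM i by auto
  qed
  have clsD: "\<exists>u. {x \<in> E. c x = i} \<subseteq> {u}" if i: "i \<notin> I" for i
  proof -
    have "x = y" if "x \<in> E" "y \<in> E" "c x = i" "c y = i" for x y
    proof -
      have "x \<in> U" "y \<in> U"
        using inU[of x] inU[of y] i that by auto
      then show ?thesis
        using cU that b by (metis bij_betw_def inj_on_eq_iff)
    qed
    then show ?thesis by blast
  qed
  have "c ` E \<subseteq> C"
    using inU cU I by (fastforce simp: D_def)
  moreover have "c x \<noteq> c y" if "x \<in> E" "y \<in> E" "R x y" for x y
  proof
    assume eq: "c x = c y"
    show False
    proof (cases "c x \<in> I")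
      case True
      then show ?thesis
        using clsI[OF True] M[OF True] that eq by auto
    next
      case False
      then show ?thesis
        using clsD[OF False] that eq irr by (metis (mono_tags, lifting) mem_Collect_eq singletonD subsetD)
    qed
  qed
  moreover have "card {x \<in> E. c x = i} = g i" if i: "i \<in> C" for i
  proof (cases "i \<in> I")
    case True
    then show ?thesis using clsI M by simp
  next
    case notI: False
    show ?thesis
    proof (cases "g i = 1")
      case True
      then have "i \<in> D" using i notI by (simp add: D_def)
      then obtain u where u: "u \<in> U" "b u = i"
        using b by (auto simp: bij_betw_def)
      then have "u \<in> {x \<in> E. c x = i}"
        using cU by (auto simp: U_def)
      then have "{x \<in> E. c x = i} = {u}"
        using clsD[OF notI] by blast
      then show ?thesis using True by simp
    next
      case False
      then have "g i = 0" using one[of i] i notI by simp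
      moreover have "c x \<noteq> i" if "x \<in> E" for x
        using inU[OF that] cU[of x] notI False by (auto simp: D_def)
      ultimately show ?thesis by (auto simp: card_eq_0_iff)
    qed
  qed
  ultimately show ?thesis
    using clsI by blast
qed

section \<open>Cubic graphs\<close>

abbreviation adjacent_edges :: "'a set \<Rightarrow> 'a set \<Rightarrow> bool" where
  "adjacent_edges e f \<equiv> e \<noteq> f \<and> e \<inter> f \<noteq> {}"

lemma cubic_graphD:
  assumes "cubic_graph H"
  shows "finite (verts H)" and "verts H \<noteq> {}" and "finite (edges H)"
    and "\<And>e. e \<in> edges H \<Longrightarrow> e \<subseteq> verts H" and "\<And>e. e \<in> edges H \<Longrightarrow> card e = 2"
    and "\<And>v. v \<in> verts H \<Longrightarrow> card {e \<in> edges H. v \<in> e} = 3"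
proof -
  show "finite (verts H)" "verts H \<noteq> {}"
    and sub: "\<And>e. e \<in> edges H \<Longrightarrow> e \<subseteq> verts H" and "\<And>e. e \<in> edges H \<Longrightarrow> card e = 2"
    and "\<And>v. v \<in> verts H \<Longrightarrow> card {e \<in> edges H. v \<in> e} = 3"
    using assms by (auto simp: cubic_graph_def simple_graph_def degree_def)
  have "edges H \<subseteq> Pow (verts H)"
    using sub by blast
  then show "finite (edges H)"
    using \<open>finite (verts H)\<close> by (meson finite_Pow_iff finite_subset)
qed

text \<open>The handshake count. It also makes the number of vertices even, which is how parity
  enters later case distinctions.\<close>

lemma cubic_card_edges:
  assumes "cubic_graph H"
  shows "2 * card (edges H) = 3 * card (verts H)"
proof -
  note H = cubic_graphD[OF assms]
  have "(\<Sum>v\<in>verts H. card {e \<in> edges H. v \<in> e}) = (\<Sum>e\<in>edges H. 2)"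
  proof (rule sum_multicount_gen[OF H(1,3)], rule ballI)
    fix e assume e: "e \<in> edges H"
    then have "{v \<in> verts H. v \<in> e} = e" using H(4) by blast
    then show "card {v \<in> verts H. v \<in> e} = 2" using H(5)[OF e] by simp
  qed
  then show ?thesis using H(6) by simp
qed

lemma cubic_card_verts_ge:
  assumes "cubic_graph H"
  shows "4 \<le> card (verts H)"
proof -
  note H = cubic_graphD[OF assms]
  obtain v where v: "v \<in> verts H" using H(2) by blast
  have "{e \<in> edges H. v \<in> e} \<subseteq> (\<lambda>w. {v, w}) ` (verts H - {v})"
  proof
    fix e assume "e \<in> {e \<in> edges H. v \<in> e}"
    then have e: "e \<in> edges H" "v \<in> e" by auto
    then obtain w where "e = {v, w}" "w \<noteq> v"
      using H(5)[OF e(1)] by (auto simp: card_2_iff)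
    then show "e \<in> (\<lambda>w. {v, w}) ` (verts H - {v})"
      using H(4)[OF e(1)] by auto
  qed
  from card_mono[OF _ this] have "3 \<le> card ((\<lambda>w. {v, w}) ` (verts H - {v}))"
    using H(6)[OF v] H(1) by simp
  also have "\<dots> \<le> card (verts H - {v})"
    using H(1) by (simp add: card_image_le)
  finally show ?thesis using v H(1) by simp
qed

text \<open>Each endpoint lies on two further edges. This bounds the degree in the line graph, to
  which the coloring lemmas for a relation \<open>R\<close> are applied.\<close>

lemma cubic_card_adjacent_edges:
  assumes "cubic_graph H" and e: "e \<in> edges H"
  shows "card {f \<in> edges H. adjacent_edges e f} \<le> 4"
proof -
  note H = cubic_graphD[OF assms(1)]
  obtain u v where uv: "e = {u, v}" "u \<noteq> v"
    using H(5)[OF e] by (auto simp: card_2_iff)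
  have two: "card ({f \<in> edges H. w \<in> f} - {e}) = 2" if "w \<in> e" for w
    using H(3) H(4)[OF e] H(6)[of w] e that by (subst card_Diff_singleton) auto
  have "card {f \<in> edges H. adjacent_edges e f}
    \<le> card (({f \<in> edges H. u \<in> f} - {e}) \<union> ({f \<in> edges H. v \<in> f} - {e}))"
    using H(3) uv by (intro card_mono) auto
  also have "\<dots> \<le> 4"
    using card_Un_le[of "{f \<in> edges H. u \<in> f} - {e}" "{f \<in> edges H. v \<in> f} - {e}"] two uv by auto
  finally show ?thesis .
qed

text \<open>Both sides have six elements, so the graph is \<open>K4\<close>.\<close>

lemma cubic_edges_card4:
  assumes "cubic_graph H" and four: "card (verts H) = 4"
  shows "edges H = {e. e \<subseteq> verts H \<and> card e = 2}"
proof (rule card_subset_eq)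
  note H = cubic_graphD[OF assms(1)]
  show "finite {e. e \<subseteq> verts H \<and> card e = 2}"
    using H(1) by simp
  show "edges H \<subseteq> {e. e \<subseteq> verts H \<and> card e = 2}"
    using H(4,5) by blast
  show "card (edges H) = card {e. e \<subseteq> verts H \<and> card e = 2}"
    using n_subsets[OF H(1), of 2] four cubic_card_edges[OF assms(1)] by (simp add: choose_two)
qed

section \<open>Edge colorings of one copy with prescribed class sizes\<close>

text \<open>Complementary edges of \<open>K4\<close> form perfect matchings. Only colors in
  \<open>S\<close> can have two edges, and only colors in \<open>S\<close> outside \<open>Sp\<close>
  occur on edges outside \<open>Sp\<close>, once each; so two perfect matchings suffice for all
  requirements.\<close>

lemma cubic_edge_coloring_K4:
  fixes H :: "'b ugraph" and C :: "'c set"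
  assumes H: "cubic_graph H" and four: "card (verts H) = 4" and finC: "finite C"
    and S: "S \<subseteq> C" "card S = 2"
    and g: "\<And>i. i \<in> C \<Longrightarrow> g i = 1 + (if i \<in> S then 1 else 0) - (if i \<in> Sp then 0 else 1 :: nat)"
    and total: "sum g C = card (edges H)"
  shows "\<exists>c. c ` edges H \<subseteq> C \<and> (\<forall>e\<in>edges H. \<forall>f\<in>edges H. adjacent_edges e f \<longrightarrow> c e \<noteq> c f) \<and>
    (\<forall>i\<in>C. card {e\<in>edges H. c e = i} = g i) \<and>
    (\<forall>e\<in>edges H. \<forall>f\<in>edges H. c e \<notin> Sp \<and> c f \<notin> Sp \<longrightarrow> \<not> adjacent_edges e f)"
proof -
  note HD = cubic_graphD[OF H]
  note E = cubic_edges_card4[OF H four]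
  have six: "card (edges H) = 6"
    using cubic_card_edges[OF H] four by simp
  have compl: "verts H - e \<in> edges H" if "e \<in> edges H" for e
    using that HD(1) four unfolding E by (auto simp: card_Diff_subset finite_subset)
  have compl_ne: "verts H - e \<noteq> e" if "e \<in> edges H" for e
    using HD(5)[OF that] HD(4)[OF that] by (metis Diff_disjoint Int_absorb card.empty zero_neq_numeral)
  obtain e where e: "e \<in> edges H"
    using six by fastforce
  have "\<not> edges H \<subseteq> {e, verts H - e}"
    using six card_mono[of "{e, verts H - e}" "edges H"] card_insert_le_m1[of 2 "{verts H - e}" e] by auto
  then obtain e' where e': "e' \<in> edges H" "e' \<noteq> e" "e' \<noteq> verts H - e"
    by blast
  define f f' where "f = verts H - e" and "f' = verts H - e'"
  have ne: "e \<noteq> f" "e' \<noteq> f'" "e' \<noteq> e" "e' \<noteq> f" "f' \<noteq> e" "f' \<noteq> f"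
    using compl_ne e e' HD(4) unfolding f_def f'_def by blast+
  have inE: "e \<in> edges H" "f \<in> edges H" "e' \<in> edges H" "f' \<in> edges H"
    using compl e e' unfolding f_def f'_def by auto
  have disj: "e \<inter> f = {}" "e' \<inter> f' = {}" "f \<inter> e = {}" "f' \<inter> e' = {}"
    unfolding f_def f'_def by auto
  obtain s t where st: "S = {s, t}" "s \<noteq> t"
    using S(2) by (auto simp: card_2_iff)
  \<comment> \<open>Two-edge classes are \<open>{e, f}\<close> and \<open>{e', f'}\<close>. If
    neither \<open>s\<close> nor \<open>t\<close> is in \<open>Sp\<close>, the single edges
    \<open>e\<close> and \<open>f\<close> are complementary, as the matching condition demands; if
    only \<open>t\<close> is not, its edge comes from the other matching.\<close>
  define M where "M i = (if i = s then (if s \<in> Sp then {e, f} else {e})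
    else if t \<in> Sp then {e', f'} else if s \<in> Sp then {e'} else {f})" for i
  have gst: "g s = (if s \<in> Sp then 2 else 1)" "g t = (if t \<in> Sp then 2 else 1)"
    using g[of s] g[of t] S(1) st by auto
  have Mst: "M s = (if s \<in> Sp then {e, f} else {e})"
    "M t = (if t \<in> Sp then {e', f'} else if s \<in> Sp then {e'} else {f})"
    using st(2) by (simp_all add: M_def)
  have Ms: "M s \<subseteq> edges H \<and> card (M s) = g s \<and> (\<forall>x\<in>M s. \<forall>y\<in>M s. \<not> adjacent_edges x y)"
    using inE ne(1) disj by (simp add: Mst gst)
  have Mt: "M t \<subseteq> edges H \<and> card (M t) = g t \<and> (\<forall>x\<in>M t. \<forall>y\<in>M t. \<not> adjacent_edges x y)"
    using inE ne(2) disj by (simp add: Mst gst)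
  have Mdisj: "M s \<inter> M t = {}"
    using ne by (auto simp: Mst)
  have "\<exists>c. c ` edges H \<subseteq> C \<and> (\<forall>e\<in>edges H. \<forall>f\<in>edges H. adjacent_edges e f \<longrightarrow> c e \<noteq> c f) \<and>
    (\<forall>i\<in>C. card {e\<in>edges H. c e = i} = g i) \<and> (\<forall>i\<in>S. {e\<in>edges H. c e = i} = M i)"
  proof (rule coloring_of_family[OF HD(3) finC S(1)])
    show "M i \<subseteq> edges H \<and> card (M i) = g i \<and> (\<forall>x\<in>M i. \<forall>y\<in>M i. \<not> adjacent_edges x y)"
      if "i \<in> S" for i
    proof (cases "i = s")
      case True
      show ?thesis unfolding True by (rule Ms)
    next
      case False
      then have "i = t" using that st(1) by blast
      show ?thesis unfolding \<open>i = t\<close> by (rule Mt)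
    qed
    show "M i \<inter> M j = {}" if "i \<in> S" "j \<in> S" "i \<noteq> j" for i j
      using that st(1) Mdisj by (metis Int_commute insertE singletonD)
    show "g i \<le> 1" if "i \<in> C - S" for i
      using that g[of i] by auto
  qed (use total in auto)
  then obtain c where c: "c ` edges H \<subseteq> C"
    "\<forall>e\<in>edges H. \<forall>f\<in>edges H. adjacent_edges e f \<longrightarrow> c e \<noteq> c f"
    "\<forall>i\<in>C. card {e\<in>edges H. c e = i} = g i" "\<forall>i\<in>S. {e\<in>edges H. c e = i} = M i"
    by (elim exE conjE)
  \<comment> \<open>A color outside both \<open>Sp\<close> and \<open>S\<close> has prescribed size
    0.\<close>
  have inM: "c x \<in> S \<and> x \<in> M (c x)" if "x \<in> edges H" "c x \<notin> Sp" for x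
  proof -
    have "{y \<in> edges H. c y = c x} \<noteq> {}" using that(1) by blast
    then have "card {y \<in> edges H. c y = c x} \<noteq> 0"
      using HD(3) by simp
    then have "g (c x) \<noteq> 0"
      using c(1,3) that by auto
    then have "c x \<in> S"
      using g[of "c x"] c(1) that by (auto split: if_splits)
    then show ?thesis
      using c(4) that(1) by auto
  qed
  have "\<not> adjacent_edges x y" if "x \<in> edges H" "y \<in> edges H" "c x \<notin> Sp" "c y \<notin> Sp" for x y
  proof -
    have "x \<in> M s \<and> c x = s \<or> x \<in> M t \<and> c x = t" "y \<in> M s \<and> c y = s \<or> y \<in> M t \<and> c y = t"
      using inM[of x] inM[of y] that st(1) by auto
    then show ?thesis
      using that disj by (elim disjE conjE) (simp_all add: Mst split: if_splits)
  qed
  then show ?thesis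
    using c(1-3) by (intro exI[of _ c]) simp
qed

text \<open>The prescribed sizes leave room for one vertex in each class outside \<open>Sp\<close>. On four vertices, Hall's
  condition for the joining edges needs in addition that the edges colored outside \<open>Sp\<close> form a matching.\<close>

lemma cubic_edge_coloring:
  fixes H :: "'b ugraph" and C :: "'c set"
  assumes H: "cubic_graph H" and finC: "finite C" and C: "card C = card (verts H) + 4"
    and Sp: "Sp \<subseteq> C" "card Sp = 4" and S: "S \<subseteq> C"
    and q: "q = (if card (verts H) < 16 then 1 else 2)"
    and r: "card S + q * (card (verts H) + 4) = card (verts H) + card (edges H)"
  shows "\<exists>c. c ` edges H \<subseteq> C \<and> (\<forall>e\<in>edges H. \<forall>f\<in>edges H. adjacent_edges e f \<longrightarrow> c e \<noteq> c f) \<and>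
    (\<forall>i\<in>C. card {e\<in>edges H. c e = i} + (if i \<in> Sp then 0 else 1) = q + (if i \<in> S then 1 else 0)) \<and>
    (card (verts H) = 4 \<longrightarrow>
      (\<forall>e\<in>edges H. \<forall>f\<in>edges H. c e \<notin> Sp \<and> c f \<notin> Sp \<longrightarrow> \<not> adjacent_edges e f))"
proof -
  note HD = cubic_graphD[OF H]
  note hs = cubic_card_edges[OF H]
  let ?n = "card (verts H)"
  have finS: "finite S" "finite Sp"
    using S Sp finC finite_subset by blast+
  \<comment> \<open>The subtraction is exact because \<open>q\<close> is at least 1.\<close>
  define g where "g i = q + (if i \<in> S then 1 else 0) - (if i \<in> Sp then 0 else 1)" for i
  have g': "g i + (if i \<in> Sp then 0 else 1) = q + (if i \<in> S then 1 else 0)" for i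
    using q by (auto simp: g_def)
  have "(\<Sum>i\<in>C. g i + (if i \<in> Sp then 0 else 1)) = (\<Sum>i\<in>C. q + (if i \<in> S then 1 else 0))"
    by (simp only: g')
  moreover have "(\<Sum>i\<in>C. if i \<in> Sp then 0 else 1 :: nat) = card (C - Sp)"
    using finC by (simp add: sum.If_cases Diff_eq)
  moreover have "card (C - Sp) = ?n"
    using Sp C finS by (simp add: card_Diff_subset)
  moreover have "(\<Sum>i\<in>C. if i \<in> S then 1 else 0 :: nat) = card S"
    using finC S by (simp add: sum.If_cases Int_absorb1)
  ultimately have total: "sum g C = card (edges H)"
    using r C by (simp add: sum.distrib algebra_simps)
  have "\<exists>c. c ` edges H \<subseteq> C \<and> (\<forall>e\<in>edges H. \<forall>f\<in>edges H. adjacent_edges e f \<longrightarrow> c e \<noteq> c f) \<and>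
    (\<forall>i\<in>C. card {e\<in>edges H. c e = i} = g i) \<and>
    (?n = 4 \<longrightarrow> (\<forall>e\<in>edges H. \<forall>f\<in>edges H. c e \<notin> Sp \<and> c f \<notin> Sp \<longrightarrow> \<not> adjacent_edges e f))"
  proof -
    \<comment> \<open>Apart from \<open>K4\<close>, parity gives at least six vertices and nine
      edges. If \<open>q = 1\<close>, only the at most four colors in \<open>S \<inter> Sp\<close>
      need two edges. If \<open>q = 2\<close>, sizes go up to three, but are exactly one outside
      \<open>S \<union> Sp\<close>.\<close>
    consider "?n = 4" | "?n \<noteq> 4" "?n < 16" | "16 \<le> ?n" by linarith
    then show ?thesis
    proof cases
      case 1
      then have "card S = 2" using r q hs by simp
      then show ?thesis
        using cubic_edge_coloring_K4[OF H 1 finC S _ _ total, of Sp] 1 q by (simp add: g_def)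
    next
      case 2
      then have "9 \<le> card (edges H)"
        using hs cubic_card_verts_ge[OF H] by presburger
      moreover have "card (S \<inter> Sp) \<le> 4"
        using card_mono[of Sp "S \<inter> Sp"] finS Sp by simp
      ultimately have "\<exists>P. finite P \<and> card P = card (S \<inter> Sp) \<and> pairwise disjnt P \<and>
        (\<forall>p\<in>P. p \<subseteq> edges H \<and> card p = 2 \<and> (\<forall>x\<in>p. \<forall>y\<in>p. \<not> adjacent_edges x y))"
        using HD(3) cubic_card_adjacent_edges[OF H] by (intro disjoint_independent_pairs) auto
      then obtain P where P: "finite P" "card P = card (S \<inter> Sp)" "pairwise disjnt P"
        "\<forall>p\<in>P. p \<subseteq> edges H \<and> card p = 2 \<and> (\<forall>x\<in>p. \<forall>y\<in>p. \<not> adjacent_edges x y)"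
        by blast
      then obtain M where M: "bij_betw M (S \<inter> Sp) P"
        using finS finite_same_card_bij[of "S \<inter> Sp" P] by auto
      then have MP: "M i \<in> P" if "i \<in> S \<inter> Sp" for i
        using that bij_betwE by blast
      have "\<exists>c. c ` edges H \<subseteq> C \<and> (\<forall>e\<in>edges H. \<forall>f\<in>edges H. adjacent_edges e f \<longrightarrow> c e \<noteq> c f) \<and>
        (\<forall>i\<in>C. card {e\<in>edges H. c e = i} = g i) \<and> (\<forall>i\<in>S \<inter> Sp. {e\<in>edges H. c e = i} = M i)"
      proof (rule coloring_of_family[OF HD(3) finC])
        show "M i \<subseteq> edges H \<and> card (M i) = g i \<and> (\<forall>x\<in>M i. \<forall>y\<in>M i. \<not> adjacent_edges x y)"
          if "i \<in> S \<inter> Sp" for i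
          using P(4) MP[OF that] that 2 q by (simp add: g_def)
        show "M i \<inter> M j = {}" if ij: "i \<in> S \<inter> Sp" "j \<in> S \<inter> Sp" "i \<noteq> j" for i j
        proof -
          have "M i \<noteq> M j"
            using M ij by (metis bij_betw_def inj_on_eq_iff)
          then show ?thesis
            using P(3) MP ij by (metis disjnt_def pairwiseD)
        qed
        show "g i \<le> 1" if "i \<in> C - S \<inter> Sp" for i
          using that 2 q by (auto simp: g_def)
      qed (use S total in auto)
      then obtain c where "c ` edges H \<subseteq> C"
        "\<forall>e\<in>edges H. \<forall>f\<in>edges H. adjacent_edges e f \<longrightarrow> c e \<noteq> c f"
        "\<forall>i\<in>C. card {e\<in>edges H. c e = i} = g i"
        by (elim exE conjE)
      then show ?thesis
        using 2(1) by (intro exI[of _ c]) simp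
    next
      case 3
      let ?I = "S \<union> Sp"
      have I: "?I \<subseteq> C" "finite ?I" using S Sp finS by auto
      have rest: "sum g (C - ?I) = card (C - ?I)"
        using 3 q by (simp add: g_def)
      moreover have "sum g C = sum g (C - ?I) + sum g ?I"
        using I finC by (simp add: sum.subset_diff)
      moreover have "card (C - ?I) = card C - card ?I"
        using I by (simp add: card_Diff_subset)
      moreover have "card ?I \<le> card S + 4"
        using card_Un_le[of S Sp] Sp by simp
      \<comment> \<open>With \<open>q = 2\<close>, \<open>card S = n / 2 - 8\<close>, where
        \<open>n\<close> is the number of vertices. So at least \<open>n / 2 + 8\<close> of the
        \<open>n + 4\<close> colors lie outside \<open>?I\<close>, and each of them takes one
        edge.\<close>
      ultimately have "sum g ?I + 8 \<le> card (edges H)"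
        using 3 q r C hs total by simp
      then have "\<exists>M. (\<forall>i\<in>?I. M i \<subseteq> edges H \<and> card (M i) = g i \<and>
          (\<forall>x\<in>M i. \<forall>y\<in>M i. \<not> adjacent_edges x y)) \<and>
        (\<forall>i\<in>?I. \<forall>j\<in>?I. i \<noteq> j \<longrightarrow> M i \<inter> M j = {})"
        using HD(3) cubic_card_adjacent_edges[OF H] I(2) 3 q
        by (intro disjoint_independent_family) (auto simp: g_def)
      then obtain M where M: "\<forall>i\<in>?I. M i \<subseteq> edges H \<and> card (M i) = g i \<and>
          (\<forall>x\<in>M i. \<forall>y\<in>M i. \<not> adjacent_edges x y)"
        "\<forall>i\<in>?I. \<forall>j\<in>?I. i \<noteq> j \<longrightarrow> M i \<inter> M j = {}"
        by (elim exE conjE)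
      have "\<exists>c. c ` edges H \<subseteq> C \<and> (\<forall>e\<in>edges H. \<forall>f\<in>edges H. adjacent_edges e f \<longrightarrow> c e \<noteq> c f) \<and>
        (\<forall>i\<in>C. card {e\<in>edges H. c e = i} = g i) \<and> (\<forall>i\<in>?I. {e\<in>edges H. c e = i} = M i)"
      proof (rule coloring_of_family[OF HD(3) finC I(1)])
        show "g i \<le> 1" if "i \<in> C - ?I" for i
          using that 3 q by (auto simp: g_def)
      qed (use M total in auto)
      then obtain c where "c ` edges H \<subseteq> C"
        "\<forall>e\<in>edges H. \<forall>f\<in>edges H. adjacent_edges e f \<longrightarrow> c e \<noteq> c f"
        "\<forall>i\<in>C. card {e\<in>edges H. c e = i} = g i"
        by (elim exE conjE)
      then show ?thesis
        using 3 by (intro exI[of _ c]) simp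
    qed
  qed
  then obtain c where "c ` edges H \<subseteq> C" "\<forall>e\<in>edges H. \<forall>f\<in>edges H. adjacent_edges e f \<longrightarrow> c e \<noteq> c f"
    "\<forall>i\<in>C. card {e\<in>edges H. c e = i} = g i"
    "?n = 4 \<longrightarrow> (\<forall>e\<in>edges H. \<forall>f\<in>edges H. c e \<notin> Sp \<and> c f \<notin> Sp \<longrightarrow> \<not> adjacent_edges e f)"
    by (elim exE conjE)
  then show ?thesis
    using g' by (intro exI[of _ c]) simp
qed

text \<open>Colors one copy of \<open>H\<close> together with the edges joining it to its vertex \<open>v\<close> of \<open>G\<close>: \<open>Sp\<close> are the
  four colors of \<open>v\<close> and of its edges in \<open>G\<close>, \<open>a\<close> and \<open>b\<close> color the vertices and edges of the copy,
  and \<open>l\<close> the joining edges. The value of \<open>q\<close> is the average size of a color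
  class in the copy, rounded down. For six and for four vertices
  a three-element set is the only one for which Hall's condition is not a matter of counting degrees.\<close>

lemma cubic_corona_extension:
  fixes H :: "'b ugraph" and C :: "'c set"
  assumes H: "cubic_graph H" and finC: "finite C" and C: "card C = card (verts H) + 4"
    and Sp: "Sp \<subseteq> C" "card Sp = 4" and S: "S \<subseteq> C"
    and q: "q = (if card (verts H) < 16 then 1 else 2)"
    and r: "card S + q * (card (verts H) + 4) = card (verts H) + card (edges H)"
  shows "\<exists>a b l. bij_betw a (verts H) (C - Sp) \<and> bij_betw l (verts H) (C - Sp) \<and> b ` edges H \<subseteq> C \<and>
    (\<forall>e\<in>edges H. \<forall>f\<in>edges H. adjacent_edges e f \<longrightarrow> b e \<noteq> b f) \<and>
    (\<forall>x\<in>verts H. a x \<noteq> l x) \<and> (\<forall>e\<in>edges H. \<forall>x\<in>e. a x \<noteq> b e \<and> l x \<noteq> b e) \<and>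
    (\<forall>i\<in>C. card {x\<in>verts H. a x = i} + card {e\<in>edges H. b e = i} = q + (if i \<in> S then 1 else 0))"
proof -
  note HD = cubic_graphD[OF H]
  let ?V = "verts H" and ?E = "edges H" and ?n = "card (verts H)" and ?Y = "C - Sp"
  have n: "4 \<le> ?n" "?n = 4 \<or> 6 \<le> ?n" "?n \<noteq> 7"
    using cubic_card_verts_ge[OF H] cubic_card_edges[OF H] by presburger+
  have finY: "finite ?Y" and cardY: "card ?Y = ?n"
    using Sp C finC by (auto simp: card_Diff_subset finite_subset)
  obtain b where b: "b ` ?E \<subseteq> C" "\<forall>e\<in>?E. \<forall>f\<in>?E. adjacent_edges e f \<longrightarrow> b e \<noteq> b f"
    and size: "\<forall>i\<in>C. card {e\<in>?E. b e = i} + (if i \<in> Sp then 0 else 1) = q + (if i \<in> S then 1 else 0)"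
    and four: "?n = 4 \<longrightarrow> (\<forall>e\<in>?E. \<forall>f\<in>?E. b e \<notin> Sp \<and> b f \<notin> Sp \<longrightarrow> \<not> adjacent_edges e f)"
    using cubic_edge_coloring[OF assms] by (elim exE conjE)
  define sees where "sees x i \<longleftrightarrow> (\<exists>e\<in>?E. x \<in> e \<and> b e = i)" for x i
  \<comment> \<open>A bound for the nonspecial colors on the three edges at a vertex; on four
    vertices the matching condition lowers it to one.\<close>
  define d :: nat where "d = (if ?n = 4 then 1 else 3)"
  have seen_le: "card {i \<in> ?Y. sees x i} \<le> d" if x: "x \<in> ?V" for x
  proof (cases "?n = 4")
    case True
    have "i = j" if ij: "i \<in> {i \<in> ?Y. sees x i}" "j \<in> {i \<in> ?Y. sees x i}" for i j
    proof -
      obtain e f where e: "e \<in> ?E" "x \<in> e" "b e = i" "i \<notin> Sp" and f: "f \<in> ?E" "x \<in> f" "b f = j" "j \<notin> Sp"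
        using ij unfolding sees_def by auto
      then have "\<not> adjacent_edges e f" using four True by simp
      then show ?thesis using e f by auto
    qed
    then have "card {i \<in> ?Y. sees x i} \<le> Suc 0"
      using finC by (subst card_le_Suc0_iff_eq) auto
    then show ?thesis
      using True by (simp add: d_def)
  next
    case False
    have "card {i \<in> ?Y. sees x i} \<le> card (b ` {e \<in> ?E. x \<in> e})"
      using HD(3) by (intro card_mono) (auto simp: sees_def)
    also have "\<dots> \<le> card {e \<in> ?E. x \<in> e}"
      using HD(3) by (simp add: card_image_le)
    finally show ?thesis
      using HD(6)[OF x] False by (simp add: d_def)
  qed
  \<comment> \<open>A nonspecial color is on at most \<open>q\<close> edges, since one place in its
    class is kept for a vertex.\<close>
  have seeing_le: "card {x. sees x i} \<le> 2 * q" "finite {x. sees x i}" if i: "i \<in> ?Y" for i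
  proof -
    have eq: "{x. sees x i} = (\<Union>e\<in>{e \<in> ?E. b e = i}. e)"
      by (auto simp: sees_def)
    have fin: "finite e" if "e \<in> ?E" for e
      using HD(1,4) that finite_subset by blast
    then show "finite {x. sees x i}"
      unfolding eq using HD(3) by auto
    have "card {x. sees x i} \<le> (\<Sum>e\<in>{e \<in> ?E. b e = i}. card e)"
      unfolding eq using HD(3) by (intro card_UN_le) simp
    also have "\<dots> = 2 * card {e \<in> ?E. b e = i}"
      using HD(5) by simp
    also have "\<dots> \<le> 2 * q"
      using size[rule_format, of i] i by (auto split: if_splits)
    finally show "card {x. sees x i} \<le> 2 * q" .
  qed
  have "\<exists>a. bij_betw a ?V ?Y \<and> (\<forall>x\<in>?V. \<not> sees x (a x))"
  proof (rule bij_betw_avoiding[OF HD(1) finY cardY[symmetric] seen_le])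
    fix A assume A: "A \<subseteq> ?V" and big: "card ?Y < card A + d"
    \<comment> \<open>Sets as large as those to be checked here have more than \<open>2 * q\<close>
      vertices, too many to see a common color.\<close>
    have False if i: "i \<in> ?Y" "\<forall>x\<in>A. sees x i" for i
    proof -
      have "card A \<le> 2 * q"
        using card_mono[of "{x. sees x i}" A] seeing_le[OF i(1)] i(2) by fastforce
      then show False
        using big cardY n q by (auto simp: d_def split: if_splits)
    qed
    then have none: "{i \<in> ?Y. \<forall>x\<in>A. sees x i} = {}" by blast
    show "card A + card {i \<in> ?Y. \<forall>x\<in>A. sees x i} \<le> card ?Y"
      unfolding none using card_mono[OF HD(1) A] cardY by simp
  qed
  then obtain a where a: "bij_betw a ?V ?Y" "\<forall>x\<in>?V. \<not> sees x (a x)"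
    by blast
  have "\<exists>l. bij_betw l ?V ?Y \<and> (\<forall>x\<in>?V. \<not> (a x = l x \<or> sees x (l x)))"
  proof (rule bij_betw_avoiding[OF HD(1) finY cardY[symmetric]])
    show "card {i \<in> ?Y. a x = i \<or> sees x i} \<le> Suc d" if "x \<in> ?V" for x
    proof -
      have "card {i \<in> ?Y. a x = i \<or> sees x i} \<le> card (insert (a x) {i \<in> ?Y. sees x i})"
        using finC by (intro card_mono) auto
      also have "\<dots> \<le> Suc d"
        using seen_le[OF that] finC by (simp add: card_insert_if)
      finally show ?thesis .
    qed
  next
    fix A assume A: "A \<subseteq> ?V" and big: "card ?Y < card A + Suc d"
    let ?Z = "{i \<in> ?Y. \<forall>x\<in>A. a x = i \<or> sees x i}"
    have inj: "inj_on a A"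
      using a(1) A by (auto simp: bij_betw_def intro: inj_on_subset)
    have finA: "finite A" using A HD(1) finite_subset by blast
    have small: "card {x \<in> A. a x = i} \<le> 1" for i
      using inj finA by (auto simp: card_le_Suc0_iff_eq inj_on_def)
    have cardA: "card A \<le> 1 + 2 * q" if i: "i \<in> ?Z" for i
    proof -
      have "A \<subseteq> {x \<in> A. a x = i} \<union> {x. sees x i}"
        using i by blast
      then have "card A \<le> card ({x \<in> A. a x = i} \<union> {x. sees x i})"
        using finA seeing_le i by (intro card_mono) auto
      also have "\<dots> \<le> card {x \<in> A. a x = i} + card {x. sees x i}"
        by (rule card_Un_le)
      finally show ?thesis
        using small[of i] seeing_le[of i] i by fastforce
    qed
    show "card A + card ?Z \<le> card ?Y"
    proof (cases "?Z = {}")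
      case True
      show ?thesis
        unfolding True using card_mono[OF HD(1) A] cardY by simp
    next
      case False
      then obtain i0 where "i0 \<in> ?Z" by blast
      then have "card A \<le> 1 + 2 * q" by (rule cardA)
      \<comment> \<open>A common bad color leaves \<open>card A\<close> at most
        \<open>1 + 2 * q\<close>, while \<open>big\<close> asks for more unless \<open>q = 1\<close>
        and \<open>n\<close> is 4 or 6.\<close>
      then have A3: "card A = 3" "?n = 4 \<or> ?n = 6" and q1: "q = 1"
        using big cardY n q by (auto simp: d_def split: if_splits)
      have "card ?Z \<le> ?n - 3"
        using A3(2)
      proof
        assume n4: "?n = 4"
        \<comment> \<open>Each color is the \<open>a\<close>-color of at most one of the three
          vertices, so some vertex of \<open>A\<close> sees both \<open>i\<close> and
          \<open>j\<close> on its edges; on four vertices it sees only one nonspecial color.\<close>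
        have "i = j" if ij: "i \<in> ?Z" "j \<in> ?Z" for i j
        proof -
          have "card ({x \<in> A. a x = i} \<union> {x \<in> A. a x = j}) \<le> 2"
            using card_Un_le[of "{x \<in> A. a x = i}" "{x \<in> A. a x = j}"] small[of i] small[of j] by linarith
          then have "\<not> A \<subseteq> {x \<in> A. a x = i} \<union> {x \<in> A. a x = j}"
            using A3(1) finA card_mono[of "{x \<in> A. a x = i} \<union> {x \<in> A. a x = j}" A] by auto
          then obtain x where x: "x \<in> A" "a x \<noteq> i" "a x \<noteq> j" by blast
          then have "i \<in> {i \<in> ?Y. sees x i}" "j \<in> {i \<in> ?Y. sees x i}"
            using ij by auto
          moreover have "card {i \<in> ?Y. sees x i} \<le> Suc 0"
            using seen_le[of x] x(1) A n4 by (auto simp: d_def)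
          ultimately show ?thesis
            using finC by (subst (asm) card_le_Suc0_iff_eq) auto
        qed
        then have "card ?Z \<le> Suc 0"
          using finC by (subst card_le_Suc0_iff_eq) auto
        then show ?thesis using n4 by simp
      next
        assume n6: "?n = 6"
        \<comment> \<open>At most two vertices see a nonspecial color, so a color bad for all three
          must be the \<open>a\<close>-color of one of them. This gives at most
          \<open>3 = 6 - 3\<close> such colors.\<close>
        have "?Z \<subseteq> a ` A"
        proof
          fix i assume i: "i \<in> ?Z"
          have "\<not> A \<subseteq> {x. sees x i}"
            using card_mono[of "{x. sees x i}" A] seeing_le[of i] i A3(1) q1 by fastforce
          then show "i \<in> a ` A" using i by auto
        qed
        then have "card ?Z \<le> card A"
          using finA by (meson card_image_le card_mono finite_imageI le_trans)
        then show ?thesis using n6 A3(1) by simp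
      qed
      then show ?thesis using A3 unfolding cardY by auto
    qed
  qed
  then obtain l where l: "bij_betw l ?V ?Y" "\<forall>x\<in>?V. \<not> (a x = l x \<or> sees x (l x))"
    by blast
  have "card {x \<in> ?V. a x = i} = (if i \<in> Sp then 0 else 1)" if iC: "i \<in> C" for i
  proof (cases "i \<in> Sp")
    case True
    then have none: "{x \<in> ?V. a x = i} = {}"
      using bij_betwE[OF a(1)] by auto
    show ?thesis unfolding none using True by simp
  next
    case False
    then obtain x where x: "x \<in> ?V" "a x = i"
      using a(1) iC by (metis DiffI bij_betw_imp_surj_on imageE)
    then have "{x \<in> ?V. a x = i} = {x}"
      using a(1) by (auto simp: bij_betw_def inj_on_def)
    then show ?thesis using False by simp
  qed
  then have "\<forall>i\<in>C. card {x\<in>?V. a x = i} + card {e\<in>?E. b e = i} = q + (if i \<in> S then 1 else 0)"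
    using size by (simp add: add.commute)
  moreover have "\<forall>e\<in>?E. \<forall>x\<in>e. a x \<noteq> b e \<and> l x \<noteq> b e"
    using a(2) l(2) HD(4) unfolding sees_def by (metis subsetD)
  ultimately show ?thesis
    using a(1) l b by (intro exI[of _ a] exI[of _ b] exI[of _ l]) simp
qed

section \<open>Coloring the base graph\<close>

text \<open>Eight colors are twice the degree bound four of the line graph, as the equitable
  coloring of the edges requires. A vertex then avoids three edge colors and at most three
  neighbors, so the greedy choice succeeds.\<close>

lemma cubic_total_coloring_equitable_edges:
  fixes G :: "'a ugraph" and C :: "'c set"
  assumes G: "cubic_graph G" and finC: "finite C" and C: "8 \<le> card C"
  shows "\<exists>a b. a ` verts G \<subseteq> C \<and> b ` edges G \<subseteq> C \<and>
    (\<forall>u\<in>verts G. \<forall>v\<in>verts G. {u, v} \<in> edges G \<longrightarrow> a u \<noteq> a v) \<and>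
    (\<forall>e\<in>edges G. \<forall>f\<in>edges G. adjacent_edges e f \<longrightarrow> b e \<noteq> b f) \<and>
    (\<forall>e\<in>edges G. \<forall>v\<in>e. a v \<noteq> b e) \<and>
    (\<forall>i\<in>C. \<forall>j\<in>C. card {e\<in>edges G. b e = i} \<le> card {e\<in>edges G. b e = j} + 1)"
proof -
  note GD = cubic_graphD[OF G]
  have "\<exists>b. b ` edges G \<subseteq> C \<and> (\<forall>e\<in>edges G. \<forall>f\<in>edges G. adjacent_edges e f \<longrightarrow> b e \<noteq> b f) \<and>
    (\<forall>i\<in>C. \<forall>j\<in>C. card {e\<in>edges G. b e = i} \<le> card {e\<in>edges G. b e = j} + 1)"
    by (rule equitable_coloring[OF GD(3) finC, of _ 4])
      (use cubic_card_adjacent_edges[OF G] C in auto)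
  then obtain b where b: "b ` edges G \<subseteq> C" "\<forall>e\<in>edges G. \<forall>f\<in>edges G. adjacent_edges e f \<longrightarrow> b e \<noteq> b f"
    "\<forall>i\<in>C. \<forall>j\<in>C. card {e\<in>edges G. b e = i} \<le> card {e\<in>edges G. b e = j} + 1"
    by (elim exE conjE)
  have "\<exists>a. (\<forall>v\<in>verts G. a v \<in> C - b ` {e \<in> edges G. v \<in> e}) \<and>
    (\<forall>u\<in>verts G. \<forall>v\<in>verts G. {u, v} \<in> edges G \<longrightarrow> a u \<noteq> a v)"
  proof (rule greedy_coloring[OF GD(1) finC])
    show "{v, u} \<in> edges G" if "{u, v} \<in> edges G" for u v
      using that by (simp add: insert_commute)
    show "{v, v} \<notin> edges G" for v
      using GD(5)[of "{v, v}"] by auto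
  next
    fix v assume v: "v \<in> verts G"
    let ?E = "{e \<in> edges G. v \<in> e}"
    have "card (b ` ?E) \<le> 3"
      using GD(6)[OF v] GD(3) card_image_le[of ?E b] by simp
    moreover have "card {u \<in> verts G. {v, u} \<in> edges G} \<le> card ?E"
      by (rule card_inj_on_le[of "\<lambda>u. {v, u}"]) (use GD(3) in \<open>auto simp: inj_on_def doubleton_eq_iff\<close>)
    ultimately show "finite (b ` ?E) \<and> card (b ` ?E) + card {u \<in> verts G. {v, u} \<in> edges G} < card C"
      using GD(3) GD(6)[OF v] C by simp
  qed
  then obtain a where a: "\<forall>v\<in>verts G. a v \<in> C - b ` {e \<in> edges G. v \<in> e}"
    "\<forall>u\<in>verts G. \<forall>v\<in>verts G. {u, v} \<in> edges G \<longrightarrow> a u \<noteq> a v"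
    by (elim exE conjE)
  have "a ` verts G \<subseteq> C" using a(1) by auto
  moreover have "\<forall>e\<in>edges G. \<forall>v\<in>e. a v \<noteq> b e"
    using a(1) GD(4) by fastforce
  ultimately show ?thesis
    using a(2) b by (intro exI[of _ a] exI[of _ b]) simp
qed

section \<open>The corona\<close>

abbreviation copy_edge :: "'a \<Rightarrow> 'b set \<Rightarrow> ('a + 'a \<times> 'b) set" where
  "copy_edge v e \<equiv> (\<lambda>x. Inr (v, x)) ` e"

text \<open>A nonempty edge records which copy it lies in; the empty set would not determine
  \<open>v\<close>.\<close>

lemma copy_edge_eq_iff:
  assumes "e \<noteq> {}"
  shows "copy_edge v e = copy_edge w f \<longleftrightarrow> v = w \<and> e = f"
proof
  assume eq: "copy_edge v e = copy_edge w f"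
  obtain x where "x \<in> e" using assms by blast
  then have "Inr (v, x) \<in> copy_edge w f" using eq by blast
  then have "v = w" by auto
  moreover have "e = f"
    using eq unfolding \<open>v = w\<close> by (simp add: inj_image_eq_iff inj_on_def)
  ultimately show "v = w \<and> e = f" ..
qed simp

lemma simple_graphD:
  assumes "simple_graph G"
  shows "finite (verts G)" and "finite (edges G)" and "\<And>e. e \<in> edges G \<Longrightarrow> e \<noteq> {}"
    and "\<And>e x. e \<in> edges G \<Longrightarrow> x \<in> e \<Longrightarrow> x \<in> verts G"
proof -
  have "edges G \<subseteq> Pow (verts G)" and "finite (verts G)"
    using assms by (auto simp: simple_graph_def)
  then show "finite (verts G)" "finite (edges G)" "\<And>e x. e \<in> edges G \<Longrightarrow> x \<in> e \<Longrightarrow> x \<in> verts G"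
    by (auto intro: finite_subset)
  show "\<And>e. e \<in> edges G \<Longrightarrow> e \<noteq> {}"
    using assms by (force simp: simple_graph_def)
qed

lemma verts_corona: "verts (corona G H) = Inl ` verts G \<union> Inr ` (verts G \<times> verts H)"
  by (simp add: corona_def)

lemma corona_edge_cases:
  assumes "f \<in> edges (corona G H)"
  obtains (base) e where "e \<in> edges G" "f = Inl ` e"
    | (copy) v e where "v \<in> verts G" "e \<in> edges H" "f = copy_edge v e"
    | (join) v x where "v \<in> verts G" "x \<in> verts H" "f = {Inl v, Inr (v, x)}"
  using assms by (auto simp: corona_def)

lemma corona_edgeI:
  shows "e \<in> edges G \<Longrightarrow> Inl ` e \<in> edges (corona G H)"
    and "v \<in> verts G \<Longrightarrow> f \<in> edges H \<Longrightarrow> copy_edge v f \<in> edges (corona G H)"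
    and "v \<in> verts G \<Longrightarrow> x \<in> verts H \<Longrightarrow> {Inl v, Inr (v, x)} \<in> edges (corona G H)"
  by (auto simp: corona_def)

section \<open>Degrees in the corona\<close>

lemma degree_corona_Inl:
  assumes G: "simple_graph G" and H: "simple_graph H" and v: "v \<in> verts G"
  shows "degree (corona G H) (Inl v) = degree G v + card (verts H)"
proof -
  note GD = simple_graphD[OF G] and HD = simple_graphD[OF H]
  let ?j = "\<lambda>x. {Inl v, Inr (v, x)} :: ('a + 'a \<times> 'b) set"
  have eq: "{f \<in> edges (corona G H). Inl v \<in> f} = (`) Inl ` {e \<in> edges G. v \<in> e} \<union> ?j ` verts H"
  proof (intro equalityI subsetI)
    fix f assume "f \<in> {f \<in> edges (corona G H). Inl v \<in> f}"
    then have "f \<in> edges (corona G H)" and f: "Inl v \<in> f" by auto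
    then show "f \<in> (`) Inl ` {e \<in> edges G. v \<in> e} \<union> ?j ` verts H"
      by (cases rule: corona_edge_cases) auto
  qed (use v in \<open>auto intro: corona_edgeI\<close>)
  have "card ((`) Inl ` {e \<in> edges G. v \<in> e} \<union> ?j ` verts H)
    = card ((`) Inl ` {e \<in> edges G. v \<in> e} :: ('a + 'a \<times> 'b) set set) + card (?j ` verts H)"
    using GD(2) HD(1) by (intro card_Un_disjoint) auto
  also have "card ((`) Inl ` {e \<in> edges G. v \<in> e} :: ('a + 'a \<times> 'b) set set) = degree G v"
    unfolding degree_def by (rule card_image) (simp add: inj_on_def inj_image_eq_iff)
  also have "card (?j ` verts H) = card (verts H)"
    by (rule card_image) (auto simp: inj_on_def doubleton_eq_iff)
  finally show ?thesis
    by (simp add: degree_def eq)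
qed

lemma degree_corona_Inr:
  assumes G: "simple_graph G" and H: "simple_graph H" and v: "v \<in> verts G" and x: "x \<in> verts H"
  shows "degree (corona G H) (Inr (v, x)) = degree H x + 1"
proof -
  note HD = simple_graphD[OF H]
  let ?c = "copy_edge v ` {e \<in> edges H. x \<in> e}" and ?j = "{Inl v, Inr (v, x)}"
  have eq: "{f \<in> edges (corona G H). Inr (v, x) \<in> f} = insert ?j ?c"
  proof (intro equalityI subsetI)
    fix f assume "f \<in> {f \<in> edges (corona G H). Inr (v, x) \<in> f}"
    then have "f \<in> edges (corona G H)" and f: "Inr (v, x) \<in> f" by auto
    then show "f \<in> insert ?j ?c"
      by (cases rule: corona_edge_cases) auto
  qed (use v x in \<open>auto intro: corona_edgeI\<close>)
  have "card ?c = degree H x"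
    unfolding degree_def
    by (rule card_image) (use HD(3) in \<open>simp add: inj_on_def copy_edge_eq_iff\<close>)
  moreover have "?j \<notin> ?c" by auto
  moreover have "finite ?c" using HD(2) by simp
  ultimately show ?thesis
    by (simp add: degree_def eq)
qed

lemma max_degree_corona_cubic:
  assumes G: "cubic_graph G" and H: "cubic_graph H"
  shows "max_degree (corona G H) = card (verts H) + 3"
proof -
  have sG: "simple_graph G" and sH: "simple_graph H"
    using G H by (auto simp: cubic_graph_def)
  note GD = cubic_graphD[OF G] and HD = cubic_graphD[OF H]
  have Inl: "degree (corona G H) (Inl v) = card (verts H) + 3" if "v \<in> verts G" for v
    using degree_corona_Inl[OF sG sH that] GD(6)[OF that] by (simp add: degree_def)
  have Inr: "degree (corona G H) (Inr (v, x)) = 4" if "v \<in> verts G" "x \<in> verts H" for v x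
    using degree_corona_Inr[OF sG sH that] HD(6)[OF that(2)] by (simp add: degree_def)
  obtain v where "v \<in> verts G" using GD(2) by blast
  show ?thesis
    unfolding max_degree_def
  proof (rule Max_eqI)
    show "finite (degree (corona G H) ` verts (corona G H))"
      using GD(1) HD(1) by (simp add: verts_corona)
    show "d \<le> card (verts H) + 3" if "d \<in> degree (corona G H) ` verts (corona G H)" for d
      using that Inl Inr cubic_card_verts_ge[OF H] by (auto simp: verts_corona)
    have "Inl v \<in> verts (corona G H)"
      using \<open>v \<in> verts G\<close> by (simp add: verts_corona)
    then show "card (verts H) + 3 \<in> degree (corona G H) ` verts (corona G H)"
      using Inl[OF \<open>v \<in> verts G\<close>] by (metis imageI)
  qed
qed

section \<open>The lower bound\<close>

text \<open>A vertex and its incident edges are pairwise in conflict, which takes one color more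
  than the degree.\<close>

lemma degree_less_colors:
  assumes c: "total_coloring X k c" and v: "v \<in> verts X"
  shows "degree X v < k"
proof (cases "finite {e \<in> edges X. v \<in> e}")
  case True
  let ?E = "{e \<in> edges X. v \<in> e}"
  have "inj_on (\<lambda>e. c (Inr e)) ?E"
    using c unfolding total_coloring_def inj_on_def by blast
  then have "card ((\<lambda>e. c (Inr e)) ` ?E) = degree X v"
    by (simp add: card_image degree_def)
  moreover have "c (Inl v) \<notin> (\<lambda>e. c (Inr e)) ` ?E"
    using c v unfolding total_coloring_def by auto
  ultimately have card: "card (insert (c (Inl v)) ((\<lambda>e. c (Inr e)) ` ?E)) = Suc (degree X v)"
    using True by simp
  have sub: "insert (c (Inl v)) ((\<lambda>e. c (Inr e)) ` ?E) \<subseteq> {..<k}"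
    using c v unfolding total_coloring_def by auto
  show ?thesis
    using card_mono[OF finite_lessThan sub] unfolding card by simp
next
  \<comment> \<open>For infinitely many incident edges the degree is 0 by the convention for
    \<open>card\<close>, and the color of \<open>v\<close> shows that \<open>k\<close> is
    positive.\<close>
  case False
  moreover have "c (Inl v) < k"
    using c v unfolding total_coloring_def by auto
  ultimately show ?thesis
    by (simp add: degree_def)
qed

lemma max_degree_less_colors:
  assumes "simple_graph X" and "total_coloring X k c"
  shows "max_degree X < k"
proof -
  have "finite (verts X)" "verts X \<noteq> {}"
    using assms(1) by (auto simp: simple_graph_def)
  then show ?thesis
    unfolding max_degree_def using degree_less_colors[OF assms(2)] by simp
qed

section \<open>Sizes of the color classes in the corona\<close>

text \<open>The corona has five kinds of elements, each parametrized injectively, and the five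
  images are disjoint. Nonempty edges are needed to tell base edges from copy edges.\<close>

lemma card_color_class_corona:
  assumes G: "simple_graph G" and H: "simple_graph H"
  shows "card (color_class (corona G H) c i) =
    card {v \<in> verts G. c (Inl (Inl v)) = i} + (\<Sum>v\<in>verts G. card {x \<in> verts H. c (Inl (Inr (v, x))) = i}) +
    card {e \<in> edges G. c (Inr (Inl ` e)) = i} + (\<Sum>v\<in>verts G. card {e \<in> edges H. c (Inr (copy_edge v e)) = i}) +
    (\<Sum>v\<in>verts G. card {x \<in> verts H. c (Inr {Inl v, Inr (v, x)}) = i})"
proof -
  note GD = simple_graphD[OF G] and HD = simple_graphD[OF H]
  define A1 where "A1 = {v \<in> verts G. c (Inl (Inl v)) = i}"
  define A2 where "A2 = (SIGMA v:verts G. {x \<in> verts H. c (Inl (Inr (v, x))) = i})"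
  define A3 where "A3 = {e \<in> edges G. c (Inr (Inl ` e)) = i}"
  define A4 where "A4 = (SIGMA v:verts G. {e \<in> edges H. c (Inr (copy_edge v e)) = i})"
  define A5 where "A5 = (SIGMA v:verts G. {x \<in> verts H. c (Inr {Inl v, Inr (v, x)}) = i})"
  let ?f1 = "\<lambda>v. Inl (Inl v) :: ('a + 'a \<times> 'b) + ('a + 'a \<times> 'b) set"
  let ?f2 = "\<lambda>p. Inl (Inr p) :: ('a + 'a \<times> 'b) + ('a + 'a \<times> 'b) set"
  let ?f3 = "\<lambda>e. Inr (Inl ` e) :: ('a + 'a \<times> 'b) + ('a + 'a \<times> 'b) set"
  let ?f4 = "\<lambda>(v, e). Inr (copy_edge v e) :: ('a + 'a \<times> 'b) + ('a + 'a \<times> 'b) set"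
  let ?f5 = "\<lambda>(v, x). Inr {Inl v, Inr (v, x)} :: ('a + 'a \<times> 'b) + ('a + 'a \<times> 'b) set"
  have fin: "finite A1" "finite A2" "finite A3" "finite A4" "finite A5"
    using GD(1,2) HD(1,2) by (auto simp: A1_def A2_def A3_def A4_def A5_def)
  have cards: "card (?f1 ` A1) = card A1" "card (?f2 ` A2) = card A2" "card (?f3 ` A3) = card A3"
    "card (?f4 ` A4) = card A4" "card (?f5 ` A5) = card A5"
    using HD(3) by (auto intro!: card_image simp: inj_on_def inj_image_eq_iff A4_def copy_edge_eq_iff doubleton_eq_iff)
  have ne: "e \<noteq> {}" if "e \<in> A3" for e
    using that GD(3) by (simp add: A3_def)
  have eq: "color_class (corona G H) c i = ?f1 ` A1 \<union> (?f2 ` A2 \<union> (?f3 ` A3 \<union> (?f4 ` A4 \<union> ?f5 ` A5)))"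
  proof (intro equalityI subsetI)
    fix z assume z: "z \<in> color_class (corona G H) c i"
    show "z \<in> ?f1 ` A1 \<union> (?f2 ` A2 \<union> (?f3 ` A3 \<union> (?f4 ` A4 \<union> ?f5 ` A5)))"
    proof (cases z)
      case (Inl w)
      then show ?thesis
        using z by (auto simp: color_class_def verts_corona A1_def A2_def)
    next
      case (Inr f)
      then have "f \<in> edges (corona G H)" "c (Inr f) = i"
        using z by (auto simp: color_class_def)
      then show ?thesis
        unfolding Inr
        by (cases rule: corona_edge_cases) (auto simp: A3_def A4_def A5_def image_iff)
    qed
  next
    fix z assume "z \<in> ?f1 ` A1 \<union> (?f2 ` A2 \<union> (?f3 ` A3 \<union> (?f4 ` A4 \<union> ?f5 ` A5)))"
    then show "z \<in> color_class (corona G H) c i"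
      by (auto simp: color_class_def verts_corona A1_def A2_def A3_def A4_def A5_def intro: corona_edgeI)
  qed
  have "?f4 ` A4 \<inter> ?f5 ` A5 = {}" by auto
  moreover have "?f3 ` A3 \<inter> (?f4 ` A4 \<union> ?f5 ` A5) = {}"
    using ne by auto
  moreover have "?f2 ` A2 \<inter> (?f3 ` A3 \<union> (?f4 ` A4 \<union> ?f5 ` A5)) = {}" by auto
  moreover have "?f1 ` A1 \<inter> (?f2 ` A2 \<union> (?f3 ` A3 \<union> (?f4 ` A4 \<union> ?f5 ` A5))) = {}" by auto
  ultimately have "card (color_class (corona G H) c i) = card A1 + (card A2 + (card A3 + (card A4 + card A5)))"
    unfolding eq using fin by (simp add: card_Un_disjoint cards del: Un_iff)
  moreover have "card A2 = (\<Sum>v\<in>verts G. card {x \<in> verts H. c (Inl (Inr (v, x))) = i})"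
    "card A4 = (\<Sum>v\<in>verts G. card {e \<in> edges H. c (Inr (copy_edge v e)) = i})"
    "card A5 = (\<Sum>v\<in>verts G. card {x \<in> verts H. c (Inr {Inl v, Inr (v, x)}) = i})"
    using GD(1) HD(1,2) by (auto simp: A2_def A4_def A5_def card_SigmaI)
  ultimately show ?thesis
    by (simp add: A1_def A3_def)
qed

section \<open>Assembling a coloring of the corona\<close>

text \<open>The kind of an edge is read off from its two parts: base edges have no
  \<open>Inr\<close> part, copy edges no \<open>Inl\<close> part, joining edges have both. Values on
  sets that are not edges do not matter.\<close>

definition corona_coloring ::
  "('a \<Rightarrow> nat) \<Rightarrow> ('a set \<Rightarrow> nat) \<Rightarrow> ('a \<Rightarrow> 'b \<Rightarrow> nat) \<Rightarrow> ('a \<Rightarrow> 'b set \<Rightarrow> nat) \<Rightarrow> ('a \<Rightarrow> 'b \<Rightarrow> nat) \<Rightarrow>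
    ('a + 'a \<times> 'b) + ('a + 'a \<times> 'b) set \<Rightarrow> nat" where
  "corona_coloring a b a' b' l z = (case z of
      Inl (Inl v) \<Rightarrow> a v
    | Inl (Inr (v, x)) \<Rightarrow> a' v x
    | Inr f \<Rightarrow>
        if Inr -` f = {} then b (Inl -` f)
        else if Inl -` f = {} then b' (the_elem (fst ` (Inr -` f))) (snd ` (Inr -` f))
        else l (the_elem (Inl -` f)) (the_elem (snd ` (Inr -` f))))"

lemma corona_coloring_simps:
  fixes e :: "'a set" and f :: "'b set"
  shows
  "corona_coloring a b a' b' l (Inl (Inl v)) = a v"
  "corona_coloring a b a' b' l (Inl (Inr (v, x))) = a' v x"
  "corona_coloring a b a' b' l (Inr (Inl ` e)) = b e"
  "f \<noteq> {} \<Longrightarrow> corona_coloring a b a' b' l (Inr (copy_edge v f)) = b' v f"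
  "corona_coloring a b a' b' l (Inr {Inl v, Inr (v, x)}) = l v x"
proof -
  show "corona_coloring a b a' b' l (Inl (Inl v)) = a v"
    "corona_coloring a b a' b' l (Inl (Inr (v, x))) = a' v x"
    by (simp_all add: corona_coloring_def)
  have "Inl -` (Inl ` e :: ('a + 'a \<times> 'b) set) = e" "Inr -` (Inl ` e :: ('a + 'a \<times> 'b) set) = {}"
    by auto
  then show "corona_coloring a b a' b' l (Inr (Inl ` e)) = b e"
    by (simp add: corona_coloring_def)
  have "Inl -` {Inl v, Inr (v, x)} = {v}" "Inr -` {Inl v, Inr (v, x)} = {(v, x)}" by auto
  then show "corona_coloring a b a' b' l (Inr {Inl v, Inr (v, x)}) = l v x"
    by (simp add: corona_coloring_def)
  assume "f \<noteq> {}"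
  moreover have "Inl -` copy_edge v f = {}" "Inr -` copy_edge v f = Pair v ` f" by auto
  ultimately show "corona_coloring a b a' b' l (Inr (copy_edge v f)) = b' v f"
    by (simp add: corona_coloring_def image_image image_constant_conv)
qed

text \<open>The hypotheses run through the kinds of adjacent or incident elements. Different copies
  never meet, and base edges never meet copy edges, so every condition concerns the base graph or a
  single index \<open>v\<close>.\<close>

lemma total_coloring_corona:
  fixes G :: "'a ugraph" and H :: "'b ugraph"
  assumes G: "simple_graph G" and H: "simple_graph H"
    and k: "\<And>v. v \<in> verts G \<Longrightarrow> a v < k" "\<And>e. e \<in> edges G \<Longrightarrow> b e < k"
      "\<And>v x. v \<in> verts G \<Longrightarrow> x \<in> verts H \<Longrightarrow> a' v x < k"
      "\<And>v e. v \<in> verts G \<Longrightarrow> e \<in> edges H \<Longrightarrow> b' v e < k"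
      "\<And>v x. v \<in> verts G \<Longrightarrow> x \<in> verts H \<Longrightarrow> l v x < k"
    and vv: "\<And>u v. {u, v} \<in> edges G \<Longrightarrow> a u \<noteq> a v"
      "\<And>v x y. v \<in> verts G \<Longrightarrow> {x, y} \<in> edges H \<Longrightarrow> a' v x \<noteq> a' v y"
      "\<And>v x. v \<in> verts G \<Longrightarrow> x \<in> verts H \<Longrightarrow> a v \<noteq> a' v x"
    and ee: "\<And>e f. e \<in> edges G \<Longrightarrow> f \<in> edges G \<Longrightarrow> adjacent_edges e f \<Longrightarrow> b e \<noteq> b f"
      "\<And>v e f. v \<in> verts G \<Longrightarrow> e \<in> edges H \<Longrightarrow> f \<in> edges H \<Longrightarrow> adjacent_edges e f \<Longrightarrow> b' v e \<noteq> b' v f"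
      "\<And>v x y. v \<in> verts G \<Longrightarrow> x \<in> verts H \<Longrightarrow> y \<in> verts H \<Longrightarrow> x \<noteq> y \<Longrightarrow> l v x \<noteq> l v y"
      "\<And>v e x. e \<in> edges G \<Longrightarrow> v \<in> e \<Longrightarrow> x \<in> verts H \<Longrightarrow> b e \<noteq> l v x"
      "\<And>v e x. v \<in> verts G \<Longrightarrow> e \<in> edges H \<Longrightarrow> x \<in> e \<Longrightarrow> b' v e \<noteq> l v x"
    and ve: "\<And>v e. e \<in> edges G \<Longrightarrow> v \<in> e \<Longrightarrow> a v \<noteq> b e"
      "\<And>v x. v \<in> verts G \<Longrightarrow> x \<in> verts H \<Longrightarrow> a v \<noteq> l v x"
      "\<And>v e x. v \<in> verts G \<Longrightarrow> e \<in> edges H \<Longrightarrow> x \<in> e \<Longrightarrow> a' v x \<noteq> b' v e"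
      "\<And>v x. v \<in> verts G \<Longrightarrow> x \<in> verts H \<Longrightarrow> a' v x \<noteq> l v x"
  shows "total_coloring (corona G H) k (corona_coloring a b a' b' l)"
proof -
  note GD = simple_graphD[OF G] and HD = simple_graphD[OF H]
  let ?c = "corona_coloring a b a' b' l"
  note simps = corona_coloring_simps(1-3,5) corona_coloring_simps(4)[OF HD(3)]
  have "?c z < k" if "z \<in> verts (corona G H) <+> edges (corona G H)" for z
  proof (cases z)
    case (Inl w)
    then show ?thesis
      using that k by (auto simp: verts_corona simps)
  next
    case (Inr f)
    then have "f \<in> edges (corona G H)" using that by auto
    then show ?thesis
      unfolding Inr by (cases rule: corona_edge_cases) (use k in \<open>auto simp: simps\<close>)
  qed
  moreover have "?c (Inl s) \<noteq> ?c (Inl t)" if st: "{s, t} \<in> edges (corona G H)" for s t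
    using st
  proof (cases rule: corona_edge_cases)
    case (base e)
    then obtain u v where uv: "s = Inl u" "t = Inl v" by blast
    then have "Inl ` e = (Inl ` {u, v} :: ('a + 'a \<times> 'b) set)" using base(2) by simp
    then have "e = {u, v}" using inj_image_eq_iff[OF inj_Inl] by blast
    then show ?thesis using base(1) vv(1) uv by (simp add: simps)
  next
    case (copy v e)
    then obtain x y where xy: "s = Inr (v, x)" "t = Inr (v, y)" by blast
    then have "copy_edge v e = copy_edge v {x, y}" using copy(3) by simp
    then have "e = {x, y}" by (simp only: copy_edge_eq_iff[OF HD(3)[OF copy(2)]])
    then show ?thesis using copy(1,2) vv(2) xy by (simp add: simps)
  next
    case (join v x)
    then show ?thesis
      using vv(3)[of v x] by (auto simp: doubleton_eq_iff simps)
  qed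
  moreover have "?c (Inr e) \<noteq> ?c (Inr f)"
    if "e \<in> edges (corona G H)" "f \<in> edges (corona G H)" and ef: "e \<noteq> f" "e \<inter> f \<noteq> {}" for e f
    using that(1)
  proof (cases rule: corona_edge_cases)
    case e: (base e')
    show ?thesis
      using that(2)
    proof (cases rule: corona_edge_cases)
      case (base f')
      then show ?thesis using e ef ee(1)[of e' f'] by (auto simp: simps)
    next
      case (copy v f')
      then show ?thesis using e ef by auto
    next
      case (join v x)
      then show ?thesis using e ef ee(4)[of e' v x] by (auto simp: simps)
    qed
  next
    case e: (copy v e')
    show ?thesis
      using that(2)
    proof (cases rule: corona_edge_cases)
      case (base f')
      then show ?thesis using e ef by auto
    next
      case (copy w f')
      then show ?thesis using e ef ee(2)[of v e' f'] by (auto simp: simps)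
    next
      case (join w x)
      then show ?thesis using e ef ee(5)[of v e' x] by (auto simp: simps)
    qed
  next
    case e: (join v x)
    show ?thesis
      using that(2)
    proof (cases rule: corona_edge_cases)
      case (base f')
      then show ?thesis using e ef ee(4)[of f' v x] by (auto simp: simps)
    next
      case (copy w f')
      then show ?thesis using e ef ee(5)[of v f' x] by (auto simp: simps)
    next
      case (join w y)
      then show ?thesis using e ef ee(3)[of v x y] by (auto simp: simps)
    qed
  qed
  moreover have "?c (Inl s) \<noteq> ?c (Inr f)" if "f \<in> edges (corona G H)" and s: "s \<in> f" for s f
    using that(1)
  proof (cases rule: corona_edge_cases)
    case (base e)
    then show ?thesis using s ve(1) by (auto simp: simps)
  next
    case (copy v e)
    then show ?thesis using s ve(3) by (auto simp: simps)
  next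
    case (join v x)
    then show ?thesis using s ve(2,4) by (auto simp: simps)
  qed
  ultimately show ?thesis
    unfolding total_coloring_def by blast
qed

lemma corona_cubic_equitable_total_coloring:
  fixes G :: "'a ugraph" and H :: "'b ugraph"
  assumes G: "cubic_graph G" and H: "cubic_graph H"
  shows "\<exists>c. equitable_total_coloring (corona G H) (card (verts H) + 4) c"
proof -
  note GD = cubic_graphD[OF G] and HD = cubic_graphD[OF H]
  have sG: "simple_graph G" and sH: "simple_graph H"
    using G H by (auto simp: cubic_graph_def)
  define n where "n = card (verts H)"
  \<comment> \<open>A copy has \<open>5 * n / 2\<close> elements and there are \<open>n + 4\<close>
    colors, so the average class size reaches 2 exactly at \<open>n = 16\<close> and always stays
    below 3. The remainder \<open>r\<close> is thus an exact difference and at most the number of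
    colors.\<close>
  define q :: nat where "q = (if n < 16 then 1 else 2)"
  define r where "r = n + card (edges H) - q * (n + 4)"
  have "2 * card (edges H) = 3 * n" "4 \<le> n"
    using cubic_card_edges[OF H] cubic_card_verts_ge[OF H] by (auto simp: n_def)
  then have r: "r + q * (n + 4) = n + card (edges H)" and r_le: "r \<le> n + 4"
    by (auto simp: r_def q_def)
  let ?C = "{..<n + 4}"
  obtain a b where a: "a ` verts G \<subseteq> ?C" and b: "b ` edges G \<subseteq> ?C"
    and aa: "\<forall>u\<in>verts G. \<forall>v\<in>verts G. {u, v} \<in> edges G \<longrightarrow> a u \<noteq> a v"
    and bb: "\<forall>e\<in>edges G. \<forall>f\<in>edges G. adjacent_edges e f \<longrightarrow> b e \<noteq> b f"
    and ab: "\<forall>e\<in>edges G. \<forall>v\<in>e. a v \<noteq> b e"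
    and bal: "\<forall>i\<in>?C. \<forall>j\<in>?C. card {e\<in>edges G. b e = i} \<le> card {e\<in>edges G. b e = j} + 1"
    using cubic_total_coloring_equitable_edges[OF G, of ?C] \<open>4 \<le> n\<close> by auto
  define m where "m i = card {e \<in> edges G. b e = i}" for i
  have "\<exists>S. (\<forall>v\<in>verts G. S v \<subseteq> ?C \<and> card (S v) = r) \<and>
    (\<forall>i\<in>?C. \<forall>j\<in>?C. - int (m i) + int (card {v\<in>verts G. i \<in> S v})
      \<le> - int (m j) + int (card {v\<in>verts G. j \<in> S v}) + 1)"
  proof (rule balanced_subsets[OF GD(1)])
    show "- int (m i) \<le> - int (m j) + 1" if "i \<in> ?C" "j \<in> ?C" for i j
    proof -
      have "m j \<le> m i + 1" using bal that unfolding m_def by blast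
      then show ?thesis by simp
    qed
  qed (use r_le in auto)
  then obtain S where S: "\<forall>v\<in>verts G. S v \<subseteq> ?C \<and> card (S v) = r"
    and Sbal: "\<forall>i\<in>?C. \<forall>j\<in>?C. - int (m i) + int (card {v\<in>verts G. i \<in> S v})
      \<le> - int (m j) + int (card {v\<in>verts G. j \<in> S v}) + 1"
    by (elim exE conjE)
  define Sp where "Sp v = insert (a v) (b ` {e \<in> edges G. v \<in> e})" for v
  have Sp: "Sp v \<subseteq> ?C" "card (Sp v) = 4" if v: "v \<in> verts G" for v
  proof -
    show "Sp v \<subseteq> ?C" using a b v by (auto simp: Sp_def)
    have "inj_on b {e \<in> edges G. v \<in> e}"
      using bb by (auto simp: inj_on_def)
    then have "card (b ` {e \<in> edges G. v \<in> e}) = 3"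
      using GD(6)[OF v] by (simp add: card_image)
    moreover have "a v \<notin> b ` {e \<in> edges G. v \<in> e}" using ab by auto
    moreover have "finite (b ` {e \<in> edges G. v \<in> e})" using GD(3) by simp
    ultimately show "card (Sp v) = 4" by (simp add: Sp_def)
  qed
  define good where "good v a' b' l \<longleftrightarrow>
    bij_betw a' (verts H) (?C - Sp v) \<and> bij_betw l (verts H) (?C - Sp v) \<and> b' ` edges H \<subseteq> ?C \<and>
    (\<forall>e\<in>edges H. \<forall>f\<in>edges H. adjacent_edges e f \<longrightarrow> b' e \<noteq> b' f) \<and>
    (\<forall>x\<in>verts H. a' x \<noteq> l x) \<and> (\<forall>e\<in>edges H. \<forall>x\<in>e. a' x \<noteq> b' e \<and> l x \<noteq> b' e) \<and>
    (\<forall>i\<in>?C. card {x\<in>verts H. a' x = i} + card {e\<in>edges H. b' e = i} = q + (if i \<in> S v then 1 else 0))"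
    for v a' b' l
  have "\<exists>a' b' l. good v a' b' l" if v: "v \<in> verts G" for v
    unfolding good_def
    by (rule cubic_corona_extension[OF H]) (use Sp[OF v] S v r in \<open>auto simp: n_def q_def\<close>)
  then obtain a' b' l where good: "\<And>v. v \<in> verts G \<Longrightarrow> good v (a' v) (b' v) (l v)"
    by metis
  have a': "bij_betw (a' v) (verts H) (?C - Sp v)" and l: "bij_betw (l v) (verts H) (?C - Sp v)"
    and b': "b' v ` edges H \<subseteq> ?C"
    and b'b': "\<And>e f. e \<in> edges H \<Longrightarrow> f \<in> edges H \<Longrightarrow> adjacent_edges e f \<Longrightarrow> b' v e \<noteq> b' v f"
    and a'l: "\<And>x. x \<in> verts H \<Longrightarrow> a' v x \<noteq> l v x"
    and a'b': "\<And>e x. e \<in> edges H \<Longrightarrow> x \<in> e \<Longrightarrow> a' v x \<noteq> b' v e \<and> l v x \<noteq> b' v e"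
    and size: "\<And>i. i \<in> ?C \<Longrightarrow> card {x\<in>verts H. a' v x = i} + card {e\<in>edges H. b' v e = i}
      = q + (if i \<in> S v then 1 else 0)"
    if "v \<in> verts G" for v
    using good[OF that] by (simp_all add: good_def)
  \<comment> \<open>Avoiding \<open>Sp v\<close> settles at once all conflicts of copy vertices and
    joining edges with \<open>v\<close>, and of joining edges with the base edges at
    \<open>v\<close>.\<close>
  have inC: "a' v x \<in> ?C - Sp v" "l v x \<in> ?C - Sp v" if "v \<in> verts G" "x \<in> verts H" for v x
    using a'[OF that(1)] l[OF that(1)] that(2) bij_betwE by blast+
  let ?c = "corona_coloring a b a' b' l"
  have total: "total_coloring (corona G H) (n + 4) ?c"
  proof (rule total_coloring_corona[OF sG sH])
    show "a v < n + 4" if "v \<in> verts G" for v using a that by auto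
    show "b e < n + 4" if "e \<in> edges G" for e using b that by auto
    show "a' v x < n + 4" "l v x < n + 4" "a v \<noteq> a' v x" "a v \<noteq> l v x" "a' v x \<noteq> l v x"
      if "v \<in> verts G" "x \<in> verts H" for v x
      using inC[OF that] a'l[OF that] by (auto simp: Sp_def)
    show "b' v e < n + 4" if "v \<in> verts G" "e \<in> edges H" for v e
      using b'[OF that(1)] that(2) by auto
    show "a u \<noteq> a v" if "{u, v} \<in> edges G" for u v
      using aa that GD(4)[OF that] by auto
    show "a' v x \<noteq> a' v y" if "v \<in> verts G" "{x, y} \<in> edges H" for v x y
    proof -
      have "x \<noteq> y" using HD(5)[OF that(2)] by auto
      then show ?thesis
        using a'[OF that(1)] HD(4)[OF that(2)] by (auto simp: bij_betw_def inj_on_def)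
    qed
    show "b e \<noteq> b f" if "e \<in> edges G" "f \<in> edges G" "adjacent_edges e f" for e f
      using bb that by blast
    show "b' v e \<noteq> b' v f" if "v \<in> verts G" "e \<in> edges H" "f \<in> edges H" "adjacent_edges e f" for v e f
      using b'b' that by blast
    show "l v x \<noteq> l v y" if "v \<in> verts G" "x \<in> verts H" "y \<in> verts H" "x \<noteq> y" for v x y
      using l[OF that(1)] that(2-4) by (auto simp: bij_betw_def inj_on_def)
    show "b e \<noteq> l v x" if "e \<in> edges G" "v \<in> e" "x \<in> verts H" for v e x
    proof -
      have "v \<in> verts G" using GD(4)[OF that(1)] that(2) by blast
      then have "l v x \<notin> Sp v" using inC(2) that(3) by blast
      moreover have "b e \<in> Sp v" using that by (auto simp: Sp_def)
      ultimately show ?thesis by metis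
    qed
    show "b' v e \<noteq> l v x" "a' v x \<noteq> b' v e" if "v \<in> verts G" "e \<in> edges H" "x \<in> e" for v e x
      using a'b'[OF that] by auto
    show "a v \<noteq> b e" if "e \<in> edges G" "v \<in> e" for v e
      using ab that by blast
  qed
  \<comment> \<open>The term \<open>m i\<close> stands on the left so that no truncated subtraction
    occurs.\<close>
  have count: "card (color_class (corona G H) ?c i) + m i =
      (q + 1) * card (verts G) + card {v \<in> verts G. i \<in> S v}" if i: "i \<in> ?C" for i
  proof -
    have "card (color_class (corona G H) ?c i) =
      card {v \<in> verts G. a v = i} + (\<Sum>v\<in>verts G. card {x \<in> verts H. a' v x = i}) + m i +
      (\<Sum>v\<in>verts G. card {e \<in> edges H. ?c (Inr (copy_edge v e)) = i}) +
      (\<Sum>v\<in>verts G. card {x \<in> verts H. l v x = i})"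
      unfolding card_color_class_corona[OF sG sH] m_def by (simp add: corona_coloring_simps)
    moreover have "{e \<in> edges H. ?c (Inr (copy_edge v e)) = i} = {e \<in> edges H. b' v e = i}" for v
      using simple_graphD(3)[OF sH] by (auto simp: corona_coloring_simps(4))
    moreover have "(\<Sum>v\<in>verts G. card {x \<in> verts H. a' v x = i}) + (\<Sum>v\<in>verts G. card {e \<in> edges H. b' v e = i})
      = q * card (verts G) + card {v \<in> verts G. i \<in> S v}"
    proof -
      have "(\<Sum>v\<in>verts G. card {x \<in> verts H. a' v x = i} + card {e \<in> edges H. b' v e = i})
        = (\<Sum>v\<in>verts G. q + (if i \<in> S v then 1 else 0))"
        using size i by (intro sum.cong) auto
      also have "\<dots> = q * card (verts G) + (\<Sum>v\<in>verts G. if i \<in> S v then 1 else 0)"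
        by (simp add: sum.distrib)
      also have "(\<Sum>v\<in>verts G. if i \<in> S v then 1 else 0) = card {v \<in> verts G. i \<in> S v}"
        using GD(1) by (simp add: sum.If_cases Int_def)
      finally show ?thesis by (simp add: sum.distrib)
    qed
    moreover have "(\<Sum>v\<in>verts G. card {x \<in> verts H. l v x = i}) = card {v \<in> verts G. i \<notin> Sp v}"
    proof -
      have "card {x \<in> verts H. l v x = i} = (if i \<notin> Sp v then 1 else 0)" if v: "v \<in> verts G" for v
      proof (cases "i \<in> Sp v")
        case True
        then have none: "{x \<in> verts H. l v x = i} = {}"
          using inC(2)[OF v] by auto
        show ?thesis unfolding none using True by simp
      next
        case False
        then have "i \<in> l v ` verts H"
          using l[OF v] i by (simp add: bij_betw_def)
        then obtain x where x: "x \<in> verts H" "l v x = i"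
          by blast
        then have one: "{x \<in> verts H. l v x = i} = {x}"
          using l[OF v] by (auto simp: bij_betw_def inj_on_def)
        show ?thesis unfolding one using False by simp
      qed
      then show ?thesis
        using GD(1) by (simp add: sum.If_cases Int_def)
    qed
    \<comment> \<open>A vertex has \<open>i\<close> in \<open>Sp v\<close> if it is itself colored
      \<open>i\<close> or is one of the two ends of an edge colored \<open>i\<close>. These cases
      are disjoint, and so are the edges. In the class size, \<open>m i\<close> base edges thus
      replace \<open>2 * m i\<close> joining edges, which leaves \<open>- m i\<close>.\<close>
    moreover have "card {v \<in> verts G. a v = i} + 2 * m i + card {v \<in> verts G. i \<notin> Sp v} = card (verts G)"
    proof -
      let ?A = "{v \<in> verts G. a v = i}" and ?B = "\<Union>{e \<in> edges G. b e = i}"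
      have "pairwise disjnt {e \<in> edges G. b e = i}"
        using bb by (fastforce simp: pairwise_def disjnt_def)
      then have "card ?B = sum card {e \<in> edges G. b e = i}"
        using GD(1,4) by (intro card_Union_disjoint) (auto intro: finite_subset)
      also have "\<dots> = 2 * m i"
        using GD(5) by (simp add: m_def)
      finally have "card ?B = 2 * m i" .
      moreover have "?A \<inter> ?B = {}"
        using ab by fastforce
      moreover have "finite ?B"
        by (rule finite_subset[OF _ GD(1)]) (use GD(4) in blast)
      ultimately have AB: "card (?A \<union> ?B) = card ?A + 2 * m i"
        using GD(1) by (simp add: card_Un_disjoint)
      have "?A \<union> ?B = {v \<in> verts G. i \<in> Sp v}"
        using GD(4) by (auto simp: Sp_def)
      then have "card {v \<in> verts G. i \<in> Sp v} = card ?A + 2 * m i"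
        using AB by simp
      moreover have "verts G = {v \<in> verts G. i \<in> Sp v} \<union> {v \<in> verts G. i \<notin> Sp v}"
        by auto
      then have "card (verts G) = card {v \<in> verts G. i \<in> Sp v} + card {v \<in> verts G. i \<notin> Sp v}"
        using GD(1) card_Un_disjoint[of "{v \<in> verts G. i \<in> Sp v}" "{v \<in> verts G. i \<notin> Sp v}"] by auto
      ultimately show ?thesis by simp
    qed
    ultimately show ?thesis by (simp add: algebra_simps)
  qed
  have "card (color_class (corona G H) ?c i) \<le> card (color_class (corona G H) ?c j) + 1"
    if "i < n + 4" "j < n + 4" for i j
  proof -
    have "- int (m i) + int (card {v\<in>verts G. i \<in> S v}) \<le> - int (m j) + int (card {v\<in>verts G. j \<in> S v}) + 1"
      using Sbal that by blast
    then show ?thesis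
      using count[of i] count[of j] that by simp
  qed
  then show ?thesis
    using total unfolding equitable_total_coloring_def n_def by blast
qed

theorem theorem7:
  fixes G :: "'a ugraph" and H :: "'b ugraph"
  assumes "cubic_graph G" and "cubic_graph H"
  shows "equitable_total_chromatic_number (corona G H) = max_degree (corona G H) + 1 \<and>
         max_degree (corona G H) + 1 = card (verts H) + 4"
proof -
  have simple: "simple_graph (corona G H)"
    using assms by (simp add: cubic_graph_def simple_graph_corona)
  have deg: "max_degree (corona G H) + 1 = card (verts H) + 4"
    using max_degree_corona_cubic[OF assms] by simp
  moreover have "equitable_total_chromatic_number (corona G H) = card (verts H) + 4"
    unfolding equitable_total_chromatic_number_def
  proof (rule Least_equality)
    show "\<exists>c. equitable_total_coloring (corona G H) (card (verts H) + 4) c"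
      by (rule corona_cubic_equitable_total_coloring[OF assms])
    show "card (verts H) + 4 \<le> k" if "\<exists>c. equitable_total_coloring (corona G H) k c" for k
      using that max_degree_less_colors[OF simple] deg
      unfolding equitable_total_coloring_def by fastforce
  qed
  ultimately show ?thesis by simp
qed

end
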